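(* Let $c\ge 2$ and let $H_c=\{(u,h^c(u)) : u\in[0,1]\}$ be the parametrization by $u$ of the heteroclinic orbit, connecting $(0,0)$ and $(1,0)$, of the planar system $$\dot u=v,\qquad \dot v=-cv-u(1-u).$$ For $n=2,\dots,100$ let $h^c_n(u)$ be the Taylor polynomial of degree $n$, centered at $u=1$, of the unstable separatrix of the saddle point $(1,0)$, and for $m=1,\dots,10$ let $R^c_m(u)$ be the rational function (with numerator of formal degree $m+2$ and denominator of formal degree $m$) constructed from Pad\'e approximants as described in the context. Then for all $u\in(0,1)$ $$h^c_2(u)<h^c_3(u)<\cdots<h^c_{100}(u)<h^c(u)<R^c_{10}(u)<R^c_9(u)<\cdots<R^c_1(u).$$
   Context: The heteroclinic orbit $H_c$ is the branch of the unstable separatrix of the saddle $(1,0)$ that tends to the attracting node $(0,0)$ as time tends to $+\infty$; in the set $\{(u,h^c(u)):u\in[0,1]\}$ the two critical points are included as endpoints. Near $(1,0)$ the unstable separatrix (local unstable manifold) of the saddle is the graph $v=h^c(u)$ of a function analytic at $u=1$, and $h^c_n(u)$ is its Taylor polynomial of degree $n$ in powers of $u-1$. Construction of $R^c_m$. Put $r=\frac{\sqrt{c^2+4}-c}{2}$, so that $c=\frac1r-r$ and $r\in(0,\sqrt2-1]$, and put $x=1-u$, $y=v$. In these coordinates the system is $x'=-y$, $y'=(r-\frac1r)y+x(x-1)$, with saddle at the origin. Let $h^r_n(x):=h^c_n(1-x)$, i.e. the Taylor polynomial of degree $n$ at $x=0$ of the analytic function $y=h^r(x)=-rx+\cdots$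 whose graph is the local unstable manifold of the origin. Let $$R^r(x)=\frac{h^r_{22}(x)}{r\,x(x-1)}$$ (extended analytically at $x=0$), and for $1\le m\le 10$ let $P^r_{m,m}(x)$ be the Pad\'e approximant of order $(m,m)$ of $R^r(x)$ at $x=0$, i.e. the quotient of two polynomials of degree (at most) $m$ whose Taylor expansion in powers of $x$ coincides with that of $R^r(x)$ up to order $2m$. (Only the coefficients of $R^r$ up to order $2m$ are involved, so replacing $h^r_{22}$ by $h^r_{2m+2}$ gives the same $P^r_{m,m}$.) Set $R^r_m(x)=r\,x(x-1)P^r_{m,m}(x)$ and $R^c_m(u):=R^r_m(1-u)$. *)

theory Defs
  imports "HOL-Analysis.Analysis" "HOL-Computational_Algebra.Computational_Algebra"
begin

definition solves_system :: "real \<Rightarrow> real set \<Rightarrow> (real \<Rightarrow> real \<times> real) \<Rightarrow> bool" where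
  "solves_system c T z \<longleftrightarrow>
     (\<forall>t\<in>T.
        ((\<lambda>s. fst (z s)) has_real_derivative snd (z t)) (at t within T) \<and>
        ((\<lambda>s. snd (z s)) has_real_derivative
            (- c * snd (z t) - fst (z t) * (1 - fst (z t)))) (at t within T))"

text \<open>
  The orbit leaving the saddle and entering the node, together with its two endpoints. For
  \<open>c \<ge> 2\<close> there is exactly one such orbit, so the union over all connecting solutions only
  forgets the choice of the time origin.
\<close>
definition heteroclinic_orbit :: "real \<Rightarrow> (real \<times> real) set" where
  "heteroclinic_orbit c =
     {(0, 0), (1, 0)} \<union>
     {p. \<exists>z. solves_system c UNIV z \<and> (z \<longlongrightarrow> (1, 0)) at_bot \<and> (z \<longlongrightarrow> (0, 0)) at_top \<and>
             p \<in> range z}"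

definition local_unstable_manifold :: "real \<Rightarrow> (real \<times> real) set \<Rightarrow> (real \<times> real) set" where
  "local_unstable_manifold c U =
     {p. \<exists>z. solves_system c {..0} z \<and> z 0 = p \<and> (\<forall>t\<le>0. z t \<in> U) \<and>
             (z \<longlongrightarrow> (1, 0)) at_bot}"

definition real_analytic_at :: "(real \<Rightarrow> real) \<Rightarrow> real \<Rightarrow> bool" where
  "real_analytic_at f a \<longleftrightarrow> (\<exists>F. (\<lambda>x. f (a + x)) has_fps_expansion F)"

text \<open>
  \<open>h\<close> plays both roles it has in the source: on \<open>[0, 1]\<close> it parametrizes the heteroclinic
  orbit, and on a full neighbourhood of \<open>1\<close> it is the analytic function whose graph is the local
  unstable manifold of the saddle.
\<close>
definition separatrix_function :: "real \<Rightarrow> (real \<Rightarrow> real) \<Rightarrow> bool" where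
  "separatrix_function c h \<longleftrightarrow>
     heteroclinic_orbit c = {(u, h u) | u. u \<in> {0..1}} \<and>
     real_analytic_at h 1 \<and>
     (\<exists>U. open U \<and> (1, 0) \<in> U \<and>
          (\<forall>(u, v)\<in>U. (u, v) \<in> local_unstable_manifold c U \<longleftrightarrow> v = h u))"

definition taylor_poly :: "nat \<Rightarrow> (real \<Rightarrow> real) \<Rightarrow> real \<Rightarrow> real poly" where
  "taylor_poly n f a = (\<Sum>k\<le>n. smult ((deriv ^^ k) f a / fact k) ([:- a, 1:] ^ k))"

definition saddle_rate :: "real \<Rightarrow> real" where
  "saddle_rate c = (sqrt (c\<^sup>2 + 4) - c) / 2"

text \<open>
  The Taylor series at \<open>x = 0\<close> of the Taylor polynomial of degree 22, in the variable
  \<open>x = 1 - u\<close>, divided by \<open>r x (x - 1)\<close>. The singularity is removable because \<open>h 1 = 0\<close>; division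
  of formal power series cancels the common factor \<open>x\<close>.
\<close>
definition R_series :: "real \<Rightarrow> (real \<Rightarrow> real) \<Rightarrow> real fps" where
  "R_series c h =
     fps_of_poly (pcompose (taylor_poly 22 h 1) [:1, - 1:]) /
     (fps_const (saddle_rate c) * fps_X * (fps_X - 1))"

text \<open>
  Coprimality means that the rational function is evaluated in lowest terms, so that a common zero
  of \<open>p\<close> and \<open>q\<close> does not produce a spurious value through \<open>0 / 0 = 0\<close>.
\<close>
definition is_pade :: "nat \<Rightarrow> real fps \<Rightarrow> real poly \<Rightarrow> real poly \<Rightarrow> bool" where
  "is_pade m F p q \<longleftrightarrow>
     degree p \<le> m \<and> degree q \<le> m \<and> coprime p q \<and> poly q 0 \<noteq> 0 \<and>
     (\<forall>k\<le>2 * m. fps_nth (fps_of_poly p / fps_of_poly q) k = fps_nth F k)"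

text \<open>
  The pair \<open>(p, q)\<close> is determined only up to a common scalar, the function \<open>p / q\<close> is unique.
\<close>
definition pade :: "nat \<Rightarrow> real fps \<Rightarrow> real \<Rightarrow> real" where
  "pade m F = (THE f. \<exists>p q. is_pade m F p q \<and> f = (\<lambda>x. poly p x / poly q x))"

definition R_upper :: "real \<Rightarrow> (real \<Rightarrow> real) \<Rightarrow> nat \<Rightarrow> real \<Rightarrow> real" where
  "R_upper c h m u =
     (let x = 1 - u in saddle_rate c * x * (x - 1) * pade m (R_series c h) x)"

end

theory Submission
  imports Defs "HOL-Computational_Algebra.Field_as_Ring"
begin

text \<open>
  Put \<open>x = 1 - u\<close> and let \<open>w = - h\<close>, a power series in \<open>x\<close> with
  \<open>w w' = x - x\<^sup>2 - c w\<close> and \<open>w' = r - x S(x)\<close>. Everything follows from the fact that \<open>S\<close> is a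
  Stieltjes series, i.e. that all Hankel matrices \<open>(S\<^sub>i\<^sub>+\<^sub>j)\<close> and \<open>(S\<^sub>i\<^sub>+\<^sub>j\<^sub>+\<^sub>1)\<close> are positive definite.
  Their generating functions are the divided differences \<open>L\<^sub>1\<close> of \<open>x S\<close> and \<open>L\<^sub>2\<close> of \<open>S\<close>. Along the flow
  \<open>D = w(x) \<partial>\<^sub>x + w(y) \<partial>\<^sub>y\<close> they satisfy, with \<open>w = x (r - V)\<close>, \<open>V = x W\<close> and
  \<open>\<sigma> = x S(x) + V(x) + y S(y) + V(y) - c - 3 r\<close>,

  \<open>D L\<^sub>1 = \<sigma> L\<^sub>1 + 2 + x y (\<Delta>W) L\<^sub>1\<close>, \<open>D L\<^sub>2 = (\<sigma> - r) L\<^sub>2 + S(x) S(y) + (\<Delta>V) L\<^sub>1\<close>,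

  where \<open>\<Delta>\<close> is the divided difference. The coefficients of \<open>\<Delta>W\<close> and \<open>\<Delta>V\<close> are those of \<open>L\<^sub>2\<close> and \<open>L\<^sub>1\<close>
  multiplied by Cauchy matrices, and products of positive definite kernels are positive definite.
  Evaluated at the orthogonal polynomial of degree \<open>n\<close>, such a Lyapunov equation expresses a positive
  multiple of its squared norm by lower order data, which gives positivity by induction.

  In particular all Taylor coefficients of \<open>w\<close> from the second on are negative. The Taylor
  polynomials of \<open>w\<close> are therefore supersolutions lying above the orbit, so their coefficients are
  summable on \<open>(0, 1)\<close> and the series represents \<open>w\<close> there. Finally
  \<open>w / (r x (1 - x)) = 1 / (1 - r x S)\<close>, whose Pade approximants are obtained from the orthogonal
  polynomials (Gauss quadrature) and increase with \<open>m\<close> to values below the function.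
\<close>

unbundle no vec_syntax

section \<open>Positive definite quadratic forms\<close>

definition quad_form :: "nat \<Rightarrow> (nat \<Rightarrow> nat \<Rightarrow> real) \<Rightarrow> (nat \<Rightarrow> real) \<Rightarrow> real" where
  "quad_form n A v = (\<Sum>i\<le>n. \<Sum>j\<le>n. v i * v j * A i j)"

definition pos_def :: "nat \<Rightarrow> (nat \<Rightarrow> nat \<Rightarrow> real) \<Rightarrow> bool" where
  "pos_def n A \<longleftrightarrow> (\<forall>v. (\<exists>i\<le>n. v i \<noteq> 0) \<longrightarrow> 0 < quad_form n A v)"

lemma pos_defD: "pos_def n A \<Longrightarrow> i \<le> n \<Longrightarrow> v i \<noteq> 0 \<Longrightarrow> 0 < quad_form n A v"
  by (auto simp: pos_def_def)

lemma quad_form_cong: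
  "(\<And>i. i \<le> n \<Longrightarrow> u i = v i) \<Longrightarrow> (\<And>i j. i \<le> n \<Longrightarrow> j \<le> n \<Longrightarrow> A i j = B i j) \<Longrightarrow>
   quad_form n A u = quad_form n B v"
  by (auto simp: quad_form_def intro!: sum.cong)

lemma pos_def_nonneg: "pos_def n A \<Longrightarrow> 0 \<le> quad_form n A v"
  by (cases "\<exists>i\<le>n. v i \<noteq> 0") (auto simp: pos_def_def quad_form_def less_imp_le)

lemma pos_def_mono: 
  assumes "pos_def n A" "m \<le> n" shows "pos_def m A"
  unfolding pos_def_def
proof (intro allI impI)
  fix v :: "nat \<Rightarrow> real" assume "\<exists>i\<le>m. v i \<noteq> 0"
  then obtain i where i: "i \<le> m" "v i \<noteq> 0" by auto
  define u where "u = (\<lambda>i. if i \<le> m then v i else 0)"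
  have "0 < quad_form n A u"
    using assms i by (intro pos_defD[of n A i]) (auto simp: u_def)
  also have "quad_form n A u = (\<Sum>i\<le>m. \<Sum>j\<le>n. u i * u j * A i j)"
    unfolding quad_form_def using assms(2)
    by (intro sum.mono_neutral_right) (auto simp: u_def)
  also have "\<dots> = (\<Sum>i\<le>m. \<Sum>j\<le>m. u i * u j * A i j)"
    using assms(2) by (intro sum.cong refl sum.mono_neutral_right) (auto simp: u_def)
  also have "\<dots> = quad_form m A v"
    unfolding quad_form_def by (intro sum.cong refl) (auto simp: u_def)
  finally show "0 < quad_form m A v" .
qed

lemma pos_def_diag_0: "pos_def n A \<Longrightarrow> 0 < A 0 0"
  using pos_defD[OF pos_def_mono[of n A 0], of 0 "\<lambda>_. 1"] by (simp add: quad_form_def)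

lemma pos_def_diag: 
  assumes "pos_def n A" "i \<le> n" shows "0 < A i i"
proof -
  have "quad_form n A (\<lambda>j. if j = i then 1 else 0) = 
      (\<Sum>k\<le>n. \<Sum>j\<le>n. if j = i then if k = i then A i i else 0 else 0)"
    unfolding quad_form_def by (intro sum.cong refl) auto
  also have "\<dots> = A i i" using assms(2) by simp
  finally show ?thesis
    using pos_defD[of n A i "\<lambda>j. if j = i then 1 else 0"] assms by simp
qed

lemma quad_form_Suc_shift:
  assumes "\<And>i j. A i j = A j i"
  shows "quad_form (Suc n) A v =
    v 0 ^ 2 * A 0 0 + 2 * v 0 * (\<Sum>i\<le>n. v (Suc i) * A 0 (Suc i)) +
    quad_form n (\<lambda>i j. A (Suc i) (Suc j)) (\<lambda>i. v (Suc i))"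
proof -
  have "quad_form (Suc n) A v =
     v 0 ^ 2 * A 0 0 + (\<Sum>j\<le>n. v 0 * v (Suc j) * A 0 (Suc j)) + 
     ((\<Sum>i\<le>n. v (Suc i) * v 0 * A (Suc i) 0) + (\<Sum>i\<le>n. \<Sum>j\<le>n. v (Suc i) * v (Suc j) * A (Suc i) (Suc j)))"
    unfolding quad_form_def
    by (simp only: sum.atMost_Suc_shift sum.distrib power2_eq_square)
  also have "(\<Sum>i\<le>n. v (Suc i) * v 0 * A (Suc i) 0) = (\<Sum>j\<le>n. v 0 * v (Suc j) * A 0 (Suc j))"
    by (rule sum.cong) (auto simp: assms[of _ 0])
  also have "\<dots> = v 0 * (\<Sum>i\<le>n. v (Suc i) * A 0 (Suc i))"
    by (simp add: sum_distrib_left mult_ac)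
  finally show ?thesis by (simp add: quad_form_def)
qed

section \<open>Schur complements, Cholesky factors and linear systems\<close>

definition schur_compl :: "(nat \<Rightarrow> nat \<Rightarrow> real) \<Rightarrow> nat \<Rightarrow> nat \<Rightarrow> real" where
  "schur_compl A i j = A (Suc i) (Suc j) - A 0 (Suc i) * A 0 (Suc j) / A 0 0"

lemma quad_form_schur_compl:
  "quad_form n (schur_compl A) v =
     quad_form n (\<lambda>i j. A (Suc i) (Suc j)) v - (\<Sum>i\<le>n. v i * A 0 (Suc i)) ^ 2 / A 0 0"
proof -
  have "(\<Sum>i\<le>n. v i * A 0 (Suc i)) ^ 2 / A 0 0 =
     (\<Sum>i\<le>n. \<Sum>j\<le>n. v i * v j * (A 0 (Suc i) * A 0 (Suc j) / A 0 0))"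
    by (simp add: power2_eq_square sum_product sum_divide_distrib mult_ac)
  then show ?thesis
    by (simp add: quad_form_def schur_compl_def right_diff_distrib sum_subtractf)
qed

lemma pos_def_schur_compl:
  assumes sym: "\<And>i j. A i j = A j i" and "pos_def (Suc n) A"
  shows "pos_def n (schur_compl A)"
  unfolding pos_def_def
proof (intro allI impI)
  fix v :: "nat \<Rightarrow> real" assume "\<exists>i\<le>n. v i \<noteq> 0"
  then obtain i where i: "i \<le> n" "v i \<noteq> 0" by auto
  define s where "s = (\<Sum>i\<le>n. v i * A 0 (Suc i))"
  \<comment> \<open>The 0-th entry minimises the form for the given remaining entries
    \<open>v\<close>; completing the square then leaves the Schur complement.\<close>
  define u where "u = (\<lambda>i. case i of 0 \<Rightarrow> - s / A 0 0 | Suc k \<Rightarrow> v k)"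
  have A: "A 0 0 > 0" using assms(2) pos_def_diag_0 by auto
  have "0 < quad_form (Suc n) A u"
    using assms i by (intro pos_defD[of _ A "Suc i"]) (auto simp: u_def)
  also have "\<dots> = quad_form n (schur_compl A) v"
    unfolding quad_form_Suc_shift[of A, OF sym] quad_form_schur_compl using A
    by (simp add: u_def s_def[symmetric] power2_eq_square field_simps)
  finally show "0 < quad_form n (schur_compl A) v" .
qed

lemma schur_compl_sym: "(\<And>i j. A i j = A j i) \<Longrightarrow> schur_compl A i j = schur_compl A j i"
  by (simp add: schur_compl_def mult.commute)

text \<open>Cholesky factorisation by induction: the first factor is the 0-th row divided by
  \<open>sqrt (A 0 0)\<close>, the others come from the Schur complement.\<close>

lemma pos_def_gram:
  assumes "\<And>i j. A i j = A j i" and "pos_def n A"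
  shows "\<exists>F. \<forall>i\<le>n. \<forall>j\<le>n. A i j = (\<Sum>a\<le>n. F a i * F a j)"
  using assms
proof (induction n arbitrary: A)
  case 0
  then have "0 < A 0 0" by (rule_tac pos_def_diag_0)
  then show ?case by (intro exI[of _ "\<lambda>_ _. sqrt (A 0 0)"]) auto
next
  case (Suc n)
  have A: "0 < A 0 0" using Suc.prems by (rule_tac pos_def_diag_0)
  obtain F where F: "\<And>i j. i \<le> n \<Longrightarrow> j \<le> n \<Longrightarrow> schur_compl A i j = (\<Sum>a\<le>n. F a i * F a j)"
    using Suc.IH[OF schur_compl_sym pos_def_schur_compl] Suc.prems by meson
  define G where "G = (\<lambda>a i. case a of 0 \<Rightarrow> A 0 i / sqrt (A 0 0) 
     | Suc b \<Rightarrow> (case i of 0 \<Rightarrow> 0 | Suc k \<Rightarrow> F b k))"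
  have "A i j = (\<Sum>a\<le>Suc n. G a i * G a j)" if "i \<le> Suc n" "j \<le> Suc n" for i j
  proof -
    have "(\<Sum>a\<le>Suc n. G a i * G a j) = A 0 i * A 0 j / A 0 0 + (\<Sum>a\<le>n. G (Suc a) i * G (Suc a) j)"
      using A by (simp only: sum.atMost_Suc_shift) (simp add: G_def)
    also have "\<dots> = A i j"
    proof (cases i)
      case (Suc i')
      then show ?thesis
      proof (cases j)
        case (Suc j')
        with \<open>i = Suc i'\<close> that F[of i' j'] show ?thesis by (simp add: G_def schur_compl_def)
      qed (use A Suc.prems(1) in \<open>auto simp: G_def\<close>)
    qed (use A in \<open>auto simp: G_def\<close>)
    finally show ?thesis by simp
  qed
  then show ?case by blast
qed

text \<open>Gaussian elimination; the pivot \<open>A 0 0\<close> is positive at every stage.\<close>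

lemma pos_def_solve:
  assumes "\<And>i j. A i j = A j i" and "pos_def n A"
  shows "\<exists>v. \<forall>i\<le>n. (\<Sum>j\<le>n. A i j * v j) = b i"
  using assms
proof (induction n arbitrary: A b)
  case 0
  then have "0 < A 0 0" by (rule_tac pos_def_diag_0)
  then show ?case by (intro exI[of _ "\<lambda>_. b 0 / A 0 0"]) auto
next
  case (Suc n)
  have A: "0 < A 0 0" using Suc.prems by (rule_tac pos_def_diag_0)
  obtain v where v: "\<And>i. i \<le> n \<Longrightarrow> (\<Sum>j\<le>n. schur_compl A i j * v j) = b (Suc i) - b 0 * A 0 (Suc i) / A 0 0"
    using Suc.IH[OF schur_compl_sym pos_def_schur_compl, of A "\<lambda>i. b (Suc i) - b 0 * A 0 (Suc i) / A 0 0"] Suc.prems by meson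
  define s where "s = (\<Sum>j\<le>n. A 0 (Suc j) * v j)"
  define u where "u = (\<lambda>i. case i of 0 \<Rightarrow> (b 0 - s) / A 0 0 | Suc k \<Rightarrow> v k)"
  have "(\<Sum>j\<le>Suc n. A i j * u j) = b i" if "i \<le> Suc n" for i
  proof (cases i)
    case 0
    then show ?thesis using A by (simp only: sum.atMost_Suc_shift) (simp add: u_def s_def)
  next
    case (Suc k)
    have "(\<Sum>j\<le>n. schur_compl A k j * v j) = (\<Sum>j\<le>n. A (Suc k) (Suc j) * v j) - A 0 (Suc k) / A 0 0 * s"
      by (simp add: schur_compl_def left_diff_distrib sum_subtractf s_def sum_distrib_left)
         (simp add: mult_ac)
    with v[of k] Suc that A Suc.prems(1)[of "Suc k" 0] show ?thesis
      by (simp only: sum.atMost_Suc_shift) (simp add: u_def field_simps)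
  qed
  then show ?case by blast
qed

text \<open>For a Hankel matrix, \<open>v\<close> holds the coefficients of the monic orthogonal
  polynomial of degree \<open>n\<close>. Only orders below \<open>n\<close> have to be definite, so
  \<open>v\<close> is available before definiteness at order \<open>n\<close> is known.\<close>

lemma pos_def_orthogonal:
  assumes "\<And>i j. A i j = A j i" and "\<And>m. m < n \<Longrightarrow> pos_def m A"
  shows "\<exists>v. v n = (1::real) \<and> (\<forall>i<n. (\<Sum>j\<le>n. A i j * v j) = 0)"
proof (cases n)
  case (Suc m)
  obtain v where v: "\<And>i. i \<le> m \<Longrightarrow> (\<Sum>j\<le>m. A i j * v j) = - A i n"
    using pos_def_solve[of A m "\<lambda>i. - A i n"] assms(1) assms(2)[of m] Suc by auto
  show ?thesis
    using v Suc by (intro exI[of _ "v(n := 1)"]) (auto simp: less_Suc_eq_le)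
qed (auto intro: exI[of _ "\<lambda>_. 1"])

lemma quad_form_conv_rows: "quad_form n A v = (\<Sum>i\<le>n. v i * (\<Sum>j\<le>n. A i j * v j))"
  by (simp add: quad_form_def sum_distrib_left mult_ac)

text \<open>Write \<open>u = u' + u n * v\<close> with \<open>u' n = 0\<close>. The cross terms
  vanish by orthogonality, so the form is that of \<open>u'\<close>, which has lower order, plus
  \<open>(u n)^2\<close> times the last pivot.\<close>

lemma pos_def_extend:
  assumes sym: "\<And>i j. A i j = A j i" and pd: "\<And>m. m < n \<Longrightarrow> pos_def m A"
    and v: "v n = 1" "\<And>i. i < n \<Longrightarrow> (\<Sum>j\<le>n. A i j * v j) = 0"
    and pos: "0 < (\<Sum>j\<le>n. A n j * v j)"
  shows "pos_def n A"
  unfolding pos_def_def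
proof (intro allI impI)
  fix u :: "nat \<Rightarrow> real" assume "\<exists>i\<le>n. u i \<noteq> 0"
  then obtain i where i: "i \<le> n" "u i \<noteq> 0" by auto
  define u' where "u' = (\<lambda>i. u i - u n * v i)"
  define d where "d = (\<Sum>j\<le>n. A n j * v j)"
  have u'n: "u' n = 0" by (simp add: u'_def v)
  have Av: "(\<Sum>j\<le>n. A i j * v j) = (if i = n then d else 0)" if "i \<le> n" for i
    using that v(2)[of i] by (auto simp: d_def)
  have row: "(\<Sum>i\<le>n. x i * (\<Sum>j\<le>n. A i j * v j)) = x n * d" for x
  proof -
    have "(\<Sum>i\<le>n. x i * (\<Sum>j\<le>n. A i j * v j)) = (\<Sum>i\<le>n. if i = n then x n * d else 0)"
      by (intro sum.cong) (auto simp: Av)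
    then show ?thesis by simp
  qed
  have cross: "(\<Sum>i\<le>n. v i * (\<Sum>j\<le>n. A i j * x j)) = x n * d" for x
  proof -
    have "(\<Sum>i\<le>n. v i * (\<Sum>j\<le>n. A i j * x j)) = (\<Sum>j\<le>n. \<Sum>i\<le>n. v i * (A i j * x j))"
      unfolding sum_distrib_left by (rule sum.swap)
    also have "\<dots> = (\<Sum>j\<le>n. x j * (\<Sum>i\<le>n. A j i * v i))"
      by (simp add: sum_distrib_left mult_ac sym)
    finally show ?thesis by (simp add: row)
  qed
  have "quad_form n A u = quad_form n A (\<lambda>i. u' i + u n * v i)"
    by (simp add: u'_def)
  also have "\<dots> = (\<Sum>i\<le>n. (u' i + u n * v i) * ((\<Sum>j\<le>n. A i j * u' j) + u n * (\<Sum>j\<le>n. A i j * v j)))"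
    by (simp add: quad_form_conv_rows distrib_left sum.distrib sum_distrib_left mult_ac)
  also have "\<dots> = quad_form n A u' + u n * (\<Sum>i\<le>n. u' i * (\<Sum>j\<le>n. A i j * v j)) +
      u n * (\<Sum>i\<le>n. v i * (\<Sum>j\<le>n. A i j * u' j)) + (u n)^2 * (\<Sum>i\<le>n. v i * (\<Sum>j\<le>n. A i j * v j))"
    by (simp add: quad_form_conv_rows algebra_simps sum.distrib sum_distrib_left power2_eq_square)
  also have "\<dots> = quad_form n A u' + (u n)^2 * d"
    by (simp add: row cross u'n v)
  finally have eq: "quad_form n A u = quad_form n A u' + (u n)^2 * d" .
  have dpos: "d > 0" using pos by (simp add: d_def)
  show "0 < quad_form n A u"
  proof (cases n)
    case 0
    then show ?thesis using i eq u'n dpos by (simp add: quad_form_def)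
  next
    case (Suc m)
    have "quad_form n A u' = quad_form m A u'"
      using Suc u'n by (simp add: quad_form_def)
    moreover have "0 \<le> quad_form m A u'"
      using pd[of m] Suc by (simp add: pos_def_nonneg)
    moreover have "0 < quad_form m A u'" if "u n = 0"
      using that pd[of m] Suc i by (intro pos_defD[of m A i]) (auto simp: u'_def le_Suc_eq)
    ultimately show ?thesis using eq dpos
      by (cases "u n = 0") (auto intro: add_nonneg_pos)
  qed
qed

text \<open>Since \<open>1 / (i + j + s)\<close> is the integral of \<open>y^(i + j + s - 1)\<close>
  over \<open>{0..1}\<close>, the form is the integral of a continuous nonnegative function that is
  positive at \<open>y = 1\<close>.\<close>

lemma pos_def_cauchy:
  assumes "pos_def n A" and "0 < s"
  shows "pos_def n (\<lambda>i j. A i j / real (i + j + s))"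
  unfolding pos_def_def
proof (intro allI impI)
  fix v :: "nat \<Rightarrow> real" assume "\<exists>i\<le>n. v i \<noteq> 0"
  then obtain i where i: "i \<le> n" "v i \<noteq> 0" by auto
  define f where "f = (\<lambda>y. \<Sum>i\<le>n. \<Sum>j\<le>n. v i * v j * A i j * y ^ (i + j + s - 1))"
  have f: "f y = y ^ (s - 1) * quad_form n A (\<lambda>i. v i * y ^ i)" for y
    using assms(2) unfolding f_def quad_form_def sum_distrib_left
    by (intro sum.cong refl) (simp add: power_add mult_ac flip: add_diff_assoc)
  have pw: "((\<lambda>y. y ^ (k - 1)) has_integral 1 / real k) {0..1::real}" if "k > 0" for k
  proof -
    have pw: "((\<lambda>y. y ^ (k - 1)) has_integral 1 ^ k / real k - 0 ^ k / real k) {0..1::real}"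
      using that by (intro fundamental_theorem_of_calculus)
        (auto intro!: derivative_eq_intros simp flip: has_real_derivative_iff_has_vector_derivative)
    then show ?thesis using that by (simp add: power_0_left)
  qed
  have "(f has_integral (\<Sum>i\<le>n. \<Sum>j\<le>n. v i * v j * A i j * (1 / real (i + j + s)))) {0..1}"
    unfolding f_def using assms(2)
    by (intro has_integral_sum has_integral_mult_right pw) auto
  then have int: "(f has_integral quad_form n (\<lambda>i j. A i j / real (i + j + s)) v) {0..1}"
    by (simp add: quad_form_def)
  have nn: "0 \<le> f y" if "y \<in> {0..1}" for y
    using that pos_def_nonneg[OF assms(1)] by (simp add: f)
  have "f 1 > 0" using pos_defD[of n A i v] assms i by (simp add: f)
  moreover have "continuous_on {0..1} f" unfolding f_def by (intro continuous_intros)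
  ultimately have "integral {0..1} f \<noteq> 0"
    using nn integral_eq_0_iff[of 0 "1::real" f] by force
  moreover have "0 \<le> integral {0..1} f" using nn int by (intro integral_nonneg) auto
  ultimately show "0 < quad_form n (\<lambda>i j. A i j / real (i + j + s)) v"
    using int by (simp add: integral_unique)
qed

section \<open>Convolution products of positive definite kernels\<close>

lemma sum_triangle_conv_nested:
  fixes n :: nat and f :: "nat \<Rightarrow> nat \<Rightarrow> 'a::comm_monoid_add"
  shows
  "(\<Sum>p\<le>n. \<Sum>i\<le>p. f i (p - i)) = (\<Sum>k\<le>n. \<Sum>i\<le>n - k. f i k)"
proof -
  have "(\<Sum>p\<le>n. \<Sum>i\<le>p. f i (p - i)) = (\<Sum>(i, k)\<in>{(i, k). i + k \<le> n}. f i k)"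
    by (rule sum.triangle_reindex_eq[symmetric])
  also have "\<dots> = (\<Sum>(k, i)\<in>(SIGMA k:{..n}. {..n - k}). f i k)"
    by (rule sum.reindex_bij_witness[of _ "\<lambda>(k, i). (i, k)" "\<lambda>(i, k). (k, i)"]) auto
  also have "\<dots> = (\<Sum>k\<le>n. \<Sum>i\<le>n - k. f i k)"
    by (subst sum.Sigma) auto
  finally show ?thesis .
qed

lemma quad_form_sum:
  "quad_form n (\<lambda>p q. \<Sum>a\<in>I. K a p q) v = (\<Sum>a\<in>I. quad_form n (K a) v)"
  unfolding quad_form_def sum_distrib_left
  by (subst (2) sum.swap, subst sum.swap) (intro sum.cong refl sum.swap)

text \<open>The kernel is the coefficient matrix of the product of two generating functions. A Gram
  factorisation of \<open>A\<close> turns its form into a sum of forms of \<open>B\<close> at the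
  vectors \<open>g a\<close>, the correlations of the factors \<open>F a\<close> with
  \<open>v\<close>.\<close>

lemma quad_form_convolution_pos:
  assumes sym: "\<And>i j. A i j = A j i"
    and A: "pos_def n A" and B: "pos_def n B" and v: "i \<le> n" "v i \<noteq> 0"
  shows "0 < quad_form n (\<lambda>p q. \<Sum>i\<le>p. \<Sum>j\<le>q. A i j * B (p - i) (q - j)) v"
proof -
  obtain F where F: "\<And>i j. i \<le> n \<Longrightarrow> j \<le> n \<Longrightarrow> A i j = (\<Sum>a\<le>n. F a i * F a j)"
    using pos_def_gram[OF sym A] by blast
  define g where "g = (\<lambda>a k. \<Sum>i\<le>n - k. F a i * v (i + k))"
  have inner: "(\<Sum>p\<le>n. v p * (\<Sum>i\<le>p. F a i * c (p - i))) = (\<Sum>k\<le>n. g a k * c k)" for a and c :: "nat \<Rightarrow> real"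
  proof -
    have "(\<Sum>p\<le>n. v p * (\<Sum>i\<le>p. F a i * c (p - i))) = (\<Sum>p\<le>n. \<Sum>i\<le>p. v (i + (p - i)) * (F a i * c (p - i)))"
      by (simp add: sum_distrib_left)
    also have "\<dots> = (\<Sum>k\<le>n. \<Sum>i\<le>n - k. v (i + k) * (F a i * c k))"
      by (rule sum_triangle_conv_nested)
    also have "\<dots> = (\<Sum>k\<le>n. g a k * c k)"
      unfolding g_def sum_distrib_right by (intro sum.cong refl) (simp add: mult_ac)
    finally show ?thesis .
  qed
  define K where "K = (\<lambda>a p q. \<Sum>i\<le>p. \<Sum>j\<le>q. F a i * F a j * B (p - i) (q - j))"
  have K: "quad_form n (K a) v = quad_form n B (g a)" for a
  proof -
    define c where "c = (\<lambda>k. \<Sum>q\<le>n. v q * (\<Sum>j\<le>q. F a j * B k (q - j)))"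
    have c: "c k = (\<Sum>l\<le>n. g a l * B k l)" for k
      unfolding c_def by (rule inner)
    have "quad_form n (K a) v = (\<Sum>p\<le>n. v p * (\<Sum>q\<le>n. v q * (\<Sum>i\<le>p. \<Sum>j\<le>q. F a i * F a j * B (p - i) (q - j))))"
      by (simp add: quad_form_def K_def sum_distrib_left mult_ac)
    also have "\<dots> = (\<Sum>p\<le>n. v p * (\<Sum>q\<le>n. \<Sum>i\<le>p. F a i * (v q * (\<Sum>j\<le>q. F a j * B (p - i) (q - j)))))"
      by (simp add: sum_distrib_left mult_ac)
    also have "\<dots> = (\<Sum>p\<le>n. v p * (\<Sum>i\<le>p. F a i * c (p - i)))"
      by (subst sum.swap) (simp add: c_def sum_distrib_left)
    also have "\<dots> = (\<Sum>k\<le>n. g a k * c k)" by (rule inner)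
    also have "\<dots> = quad_form n B (g a)"
      by (simp add: c quad_form_def sum_distrib_left mult_ac)
    finally show ?thesis .
  qed
  have "(\<Sum>i\<le>p. \<Sum>j\<le>q. A i j * B (p - i) (q - j)) = (\<Sum>a\<le>n. K a p q)" if "p \<le> n" "q \<le> n" for p q
  proof -
    have "(\<Sum>i\<le>p. \<Sum>j\<le>q. A i j * B (p - i) (q - j)) =
        (\<Sum>i\<le>p. \<Sum>j\<le>q. \<Sum>a\<le>n. F a i * F a j * B (p - i) (q - j))"
      using that by (intro sum.cong refl) (simp add: F sum_distrib_right)
    also have "\<dots> = (\<Sum>i\<le>p. \<Sum>a\<le>n. \<Sum>j\<le>q. F a i * F a j * B (p - i) (q - j))"
      by (intro sum.cong refl sum.swap)
    also have "\<dots> = (\<Sum>a\<le>n. K a p q)"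
      unfolding K_def by (rule sum.swap)
    finally show ?thesis .
  qed
  then have "quad_form n (\<lambda>p q. \<Sum>i\<le>p. \<Sum>j\<le>q. A i j * B (p - i) (q - j)) v = 
      quad_form n (\<lambda>p q. \<Sum>a\<le>n. K a p q) v"
    by (intro quad_form_cong refl)
  then have eq: "quad_form n (\<lambda>p q. \<Sum>i\<le>p. \<Sum>j\<le>q. A i j * B (p - i) (q - j)) v = (\<Sum>a\<le>n. quad_form n B (g a))"
    by (simp add: quad_form_sum K)
  \<comment> \<open>Strictness: the squares of the \<open>g a 0\<close> add up to the form of
    \<open>A\<close> at \<open>v\<close>, so some \<open>g a\<close> is nonzero.\<close>
  have "0 < quad_form n A v" using A v by (rule pos_defD)
  also have "quad_form n A v = quad_form n (\<lambda>i j. \<Sum>a\<le>n. F a i * F a j) v"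
    by (intro quad_form_cong refl F)
  also have "\<dots> = (\<Sum>a\<le>n. (g a 0)^2)"
    unfolding quad_form_sum 
    by (simp add: quad_form_def g_def power2_eq_square sum_product mult_ac)
  finally obtain a where a: "a \<le> n" "g a 0 \<noteq> 0"
    by (metis (mono_tags, lifting) atMost_iff less_irrefl sum.neutral zero_power2)
  have "0 < quad_form n B (g a)"
    using B a by (intro pos_defD[of n B 0]) auto
  then show ?thesis unfolding eq using a pos_def_nonneg[OF B]
    by (intro sum_pos2[of _ a]) auto
qed

section \<open>Kernels as power series in two variables\<close>

text \<open>
  A series in two variables \<open>x, y\<close> is a series in \<open>y\<close> with coefficients in \<open>\<real>[[x]]\<close>: the
  coefficient of \<open>x\<^sup>i y\<^sup>j\<close> is \<open>F $ j $ i\<close>.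
\<close>

definition fps_inl :: "real fps \<Rightarrow> real fps fps" where
  "fps_inl f = fps_const f"

definition fps_inr :: "real fps \<Rightarrow> real fps fps" where
  "fps_inr f = Abs_fps (\<lambda>j. fps_const (f $ j))"

definition fps_swap :: "real fps fps \<Rightarrow> real fps fps" where
  "fps_swap F = Abs_fps (\<lambda>j. Abs_fps (\<lambda>i. F $ i $ j))"

definition fps_deriv_inl :: "real fps fps \<Rightarrow> real fps fps" where
  "fps_deriv_inl F = Abs_fps (\<lambda>j. fps_deriv (F $ j))"

text \<open>This is the derivation \<open>D\<close>: the vector field \<open>w\<close> acts on both
  variables at once.\<close>

definition fps_flow :: "real fps \<Rightarrow> real fps fps \<Rightarrow> real fps fps" where
  "fps_flow w F = fps_inl w * fps_deriv_inl F + fps_inr w * fps_deriv F"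

text \<open>The quotient \<open>(f(x) - f(y)) / (x - y)\<close>, given by its coefficients because
  \<open>x - y\<close> is not a unit; they form a Hankel matrix.\<close>

definition div_diff :: "real fps \<Rightarrow> real fps fps" where
  "div_diff f = Abs_fps (\<lambda>j. Abs_fps (\<lambda>i. f $ (i + j + 1)))"

lemma fps2_eqI: "(\<And>i j. F $ j $ i = G $ j $ i) \<Longrightarrow> F = G"
  by (simp add: fps_eq_iff)

lemma fps2_mult_nth: "(F * G) $ j $ i = (\<Sum>a\<le>i. \<Sum>b\<le>j. F $ b $ a * G $ (j - b) $ (i - a))"
  for F G :: "real fps fps"
  unfolding fps_mult_nth fps_sum_nth atLeast0AtMost by (rule sum.swap)

lemma fps_inl_mult_nth: "(fps_inl f * F) $ j = f * F $ j"
  by (simp add: fps_inl_def)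

lemma fps_swap_nth [simp]: "fps_swap F $ j $ i = F $ i $ j"
  by (simp add: fps_swap_def)

lemma fps_swap_swap [simp]: "fps_swap (fps_swap F) = F"
  by (rule fps2_eqI) simp

lemma fps_swap_mult: "fps_swap (F * G) = fps_swap F * fps_swap G"
  by (rule fps2_eqI) (simp add: fps2_mult_nth, rule sum.swap)

lemma fps_swap_add: "fps_swap (F + G) = fps_swap F + fps_swap G"
  by (rule fps2_eqI) simp

lemma fps_swap_inl: "fps_swap (fps_inl f) = fps_inr f"
  by (rule fps2_eqI) (simp add: fps_inl_def fps_inr_def)

lemma fps_swap_deriv_inl: "fps_swap (fps_deriv_inl F) = fps_deriv (fps_swap F)"
  by (rule fps2_eqI) (simp add: fps_deriv_inl_def fps_of_nat[symmetric] del: of_nat_Suc of_nat_add fps_of_nat)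

lemma fps_inl_mult: "fps_inl (f * g) = fps_inl f * fps_inl g"
  by (simp add: fps_inl_def)

lemma fps_inl_add: "fps_inl (f + g) = fps_inl f + fps_inl g"
  by (simp add: fps_inl_def)

lemma fps_inl_diff: "fps_inl (f - g) = fps_inl f - fps_inl g"
  by (simp add: fps_inl_def)

lemma fps_inr_mult: "fps_inr (f * g) = fps_inr f * fps_inr g"
  by (simp add: fps_inl_mult fps_swap_mult flip: fps_swap_inl)

lemma fps_inr_add: "fps_inr (f + g) = fps_inr f + fps_inr g"
  by (simp add: fps_inl_add fps_swap_add flip: fps_swap_inl)

lemma fps_inr_diff: "fps_inr (f - g) = fps_inr f - fps_inr g"
  by (rule fps2_eqI) (simp add: fps_inr_def)

lemma fps_inr_const: "fps_inr (fps_const a) = fps_inl (fps_const a)"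
  by (rule fps2_eqI) (simp add: fps_inr_def fps_inl_def)

lemma fps_deriv_inl_mult: "fps_deriv_inl (F * G) = fps_deriv_inl F * G + F * fps_deriv_inl G"
  by (rule fps_ext) (simp add: fps_deriv_inl_def fps_mult_nth fps_deriv_sum sum.distrib)

lemma fps_flow_mult: "fps_flow w (F * G) = fps_flow w F * G + F * fps_flow w G"
  by (simp add: fps_flow_def fps_deriv_inl_mult algebra_simps)

lemma fps_flow_diff: "fps_flow w (F - G) = fps_flow w F - fps_flow w G"
proof -
  have "fps_deriv_inl (F - G) = fps_deriv_inl F - fps_deriv_inl G"
    by (rule fps_ext) (simp add: fps_deriv_inl_def)
  then show ?thesis by (simp add: fps_flow_def right_diff_distrib)
qed

lemma fps_flow_inl: "fps_flow w (fps_inl f) = fps_inl (w * fps_deriv f)"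
  by (rule fps2_eqI) (simp add: fps_flow_def fps_deriv_inl_def fps_inl_def)

lemma fps_flow_inr: "fps_flow w (fps_inr f) = fps_inr (w * fps_deriv f)"
proof -
  have "fps_deriv_inl (fps_inr f) = 0"
    by (rule fps2_eqI) (simp add: fps_deriv_inl_def fps_inr_def)
  moreover have "fps_deriv (fps_inr f) = fps_inr (fps_deriv f)"
    by (rule fps2_eqI) (simp add: fps_inr_def fps_of_nat[symmetric] del: of_nat_Suc of_nat_add fps_of_nat)
  ultimately show ?thesis by (simp add: fps_flow_def fps_inr_mult)
qed

lemma fps_inr_X: "fps_inr fps_X = fps_X"
  by (rule fps2_eqI) (simp add: fps_inr_def)

lemma div_diff_nth [simp]: "div_diff f $ j $ i = f $ (i + j + 1)"
  by (simp add: div_diff_def)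

text \<open>Identities between divided differences are checked after multiplication by
  \<open>x - y\<close>, which turns them into identities in \<open>f(x)\<close> and
  \<open>f(y)\<close> and can be cancelled because it is nonzero.\<close>

lemma div_diff_eq: "(fps_inl fps_X - fps_inr fps_X) * div_diff f = fps_inl f - fps_inr f"
  unfolding fps_inr_X
proof (rule fps2_eqI)
  fix i j
  show "((fps_inl fps_X - fps_X) * div_diff f) $ j $ i = (fps_inl f - fps_inr f) $ j $ i"
    by (cases i; cases j)
       (simp_all add: fps_inl_def fps_inr_def left_diff_distrib div_diff_def)
qed

lemma inl_X_neq_inr_X: "fps_inl fps_X - fps_inr fps_X \<noteq> 0"
proof
  assume "fps_inl fps_X - fps_inr fps_X = 0"
  then have "(fps_inl fps_X - fps_inr fps_X) $ 0 $ 1 = (0 :: real)" by simp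
  then show False by (simp add: fps_inl_def fps_inr_def)
qed

section \<open>Pairing a kernel with a vector, and the Lyapunov argument\<close>

definition fps_form :: "nat \<Rightarrow> (nat \<Rightarrow> real) \<Rightarrow> real fps fps \<Rightarrow> real" where
  "fps_form n v F = quad_form n (\<lambda>i j. F $ j $ i) v"

lemma fps_form_add: "fps_form n v (F + G) = fps_form n v F + fps_form n v G"
  by (simp add: fps_form_def quad_form_def distrib_left sum.distrib)

lemma fps_form_swap: "fps_form n v (fps_swap F) = fps_form n v F"
  unfolding fps_form_def quad_form_def fps_swap_nth
  by (subst sum.swap) (simp add: mult_ac)

text \<open>The pairing is performed in \<open>y\<close> only and leaves a series in
  \<open>x\<close>.\<close>

definition fps_contract :: "nat \<Rightarrow> (nat \<Rightarrow> real) \<Rightarrow> real fps fps \<Rightarrow> real fps" where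
  "fps_contract n v F = (\<Sum>j\<le>n. fps_const (v j) * F $ j)"

lemma fps_form_conv_contract: "fps_form n v F = (\<Sum>i\<le>n. v i * fps_contract n v F $ i)"
  by (simp add: fps_form_def quad_form_def fps_contract_def fps_sum_nth sum_distrib_left mult_ac)

lemma fps_contract_inl_mult: "fps_contract n v (fps_inl f * F) = f * fps_contract n v F"
  by (simp add: fps_contract_def fps_inl_mult_nth sum_distrib_left mult.left_commute)

lemma fps_contract_deriv_inl: "fps_contract n v (fps_deriv_inl F) = fps_deriv (fps_contract n v F)"
  by (simp add: fps_contract_def fps_deriv_inl_def fps_deriv_sum)

lemma fps_form_lowest:
  assumes "\<And>i. i < n \<Longrightarrow> fps_contract n v F $ i = 0" "v n = 1"
  shows "fps_form n v F = fps_contract n v F $ n"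
proof -
  have "fps_form n v F = (\<Sum>i\<le>n. if i = n then fps_contract n v F $ n else 0)"
    unfolding fps_form_conv_contract using assms by (intro sum.cong) auto
  then show ?thesis by simp
qed

text \<open>
  Let \<open>v\<close> be the orthogonal vector of order \<open>n\<close>, with \<open>v n = 1\<close>. Contracting \<open>K\<close> with \<open>v\<close> in one
  variable leaves \<open>\<delta> x\<^sup>n + O(x\<^sup>n\<^sup>+\<^sup>1)\<close>, on which \<open>w(x) \<partial>\<^sub>x\<close> acts as \<open>n w\<^sub>1\<close>. Hence pairing the equation with
  \<open>v\<close> in both variables gives \<open>(2 n w\<^sub>1 + \<kappa>) \<delta> = C(v, v) > 0\<close>, where \<open>\<delta> = K(v, v)\<close>.
\<close>

lemma lyapunov_pos_def:
  fixes K C :: "real fps fps" and w a :: "real fps"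
  assumes eq: "fps_flow w K = (fps_inl (a - fps_const \<kappa>) + fps_inr a) * K + C"
    and w: "w $ 0 = 0" "w $ 1 > 0" and a: "a $ 0 = 0" and \<kappa>: "\<kappa> > 0"
    and sym: "\<And>i j. K $ i $ j = K $ j $ i"
    and pd: "\<And>m. m < n \<Longrightarrow> pos_def m (\<lambda>i j. K $ j $ i)"
    and C: "\<And>v. v n = 1 \<Longrightarrow> 0 < fps_form n v C"
  shows "pos_def n (\<lambda>i j. K $ j $ i)"
proof -
  obtain v where v: "v n = 1" "\<And>i. i < n \<Longrightarrow> (\<Sum>j\<le>n. K $ j $ i * v j) = 0"
    using pos_def_orthogonal[of "\<lambda>i j. K $ j $ i" n] sym pd by blast
  define f where "f = fps_contract n v K"
  define g where "g = fps_shift n f"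
  define w' where "w' = fps_shift 1 w"
  have w_eq: "w = fps_X * w'" using w by (auto simp: fps_eq_iff w'_def)
  have f_nth: "f $ i = (\<Sum>j\<le>n. K $ j $ i * v j)" for i
    by (simp add: f_def fps_contract_def fps_sum_nth mult.commute)
  have f_eq: "f = fps_X ^ n * g"
    by (rule fps_ext) (auto simp: g_def fps_X_power_mult_nth f_nth v)
  have swapK: "fps_swap K = K" by (rule fps2_eqI) (simp add: sym)
  \<comment> \<open>The product of \<open>b\<close> with \<open>f\<close> still has order at least
    \<open>n\<close>, so only \<open>b $ 0\<close> counts. Hence \<open>a\<close> drops out of the
    equation and \<open>- \<kappa>\<close> remains.\<close>
  have form_inl: "fps_form n v (fps_inl b * K) = b $ 0 * f $ n" for b
    by (subst fps_form_lowest)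
       (auto simp: fps_contract_inl_mult f_def[symmetric] v f_eq fps_X_power_mult_nth
         mult.left_commute[of _ "fps_X ^ n"])
  have "fps_X * fps_deriv (fps_X ^ n) = (of_nat n * fps_X ^ n :: real fps)"
    unfolding fps_deriv_power' by (cases n) (simp_all add: mult_ac del: of_nat_Suc)
  then have "fps_X * fps_deriv f = fps_X ^ n * (of_nat n * g + fps_X * fps_deriv g)"
    unfolding f_eq fps_deriv_mult by (simp add: algebra_simps)
  then have "w * fps_deriv f = fps_X ^ n * (w' * (of_nat n * g + fps_X * fps_deriv g))"
    by (simp add: w_eq mult_ac)
  then have flow_inl: "fps_form n v (fps_inl w * fps_deriv_inl K) = w $ 1 * n * f $ n"
    by (subst fps_form_lowest)
       (auto simp: fps_contract_inl_mult fps_contract_deriv_inl f_def[symmetric] v fps_X_power_mult_nth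
         w'_def g_def)
  \<comment> \<open>The terms acting in \<open>y\<close> reduce to those in \<open>x\<close> because
    \<open>K\<close> is symmetric.\<close>
  have "fps_form n v (fps_swap (fps_inl b * fps_swap K)) = b $ 0 * f $ n" for b
    unfolding fps_form_swap swapK by (rule form_inl)
  then have form_inr: "fps_form n v (fps_inr b * K) = b $ 0 * f $ n" for b
    by (simp add: fps_swap_mult fps_swap_inl)
  have "fps_form n v (fps_swap (fps_inl w * fps_deriv_inl (fps_swap K))) = w $ 1 * n * f $ n"
    unfolding fps_form_swap swapK by (rule flow_inl)
  then have flow_inr: "fps_form n v (fps_inr w * fps_deriv K) = w $ 1 * n * f $ n"
    by (simp add: fps_swap_mult fps_swap_inl fps_swap_deriv_inl)
  have "w $ 1 * n * f $ n + w $ 1 * n * f $ n = - \<kappa> * f $ n + fps_form n v C"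
    using arg_cong[OF eq, of "fps_form n v"] a
    by (simp add: fps_flow_def fps_form_add flow_inl[simplified] flow_inr[simplified] distrib_right form_inl form_inr)
  then have "(2 * w $ 1 * n + \<kappa>) * f $ n = fps_form n v C"
    by (simp add: algebra_simps)
  moreover have "2 * w $ 1 * n + \<kappa> > 0"
    using w \<kappa> by (intro add_nonneg_pos) auto
  ultimately have "f $ n > 0" using C[of v] v(1) by (metis zero_less_mult_pos)
  then have "0 < (\<Sum>j\<le>n. K $ j $ n * v j)" unfolding f_nth .
  then show ?thesis
    by (rule pos_def_extend[where v = v, rotated -1]) (fact sym pd v)+
qed

lemma fps_form_mult_pos:
  assumes "\<And>i j. F $ i $ j = F $ j $ i" "pos_def n (\<lambda>i j. F $ j $ i)" "pos_def n (\<lambda>i j. G $ j $ i)"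
    "i \<le> n" "v i \<noteq> 0"
  shows "0 < fps_form n v (F * G)"
  using quad_form_convolution_pos[of "\<lambda>i j. F $ j $ i" n "\<lambda>i j. G $ j $ i" i v] assms
  by (simp add: fps_form_def fps2_mult_nth)

text \<open>The factor \<open>x y\<close> lowers the order by one, so that the corresponding term in
  the equation for \<open>L1\<close> involves only smaller Hankel matrices.\<close>

lemma fps_form_XY_mult:
  "fps_form (Suc n) v (fps_inl fps_X * fps_inr fps_X * F) = fps_form n (\<lambda>i. v (Suc i)) F"
proof -
  have "(fps_inl fps_X * fps_inr fps_X * F) $ j $ i =
     (case i of 0 \<Rightarrow> 0 | Suc i' \<Rightarrow> case j of 0 \<Rightarrow> 0 | Suc j' \<Rightarrow> F $ j' $ i')" for i j
    by (cases i; cases j) (simp_all add: mult.assoc fps_inl_mult_nth fps_inr_X)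
  then show ?thesis
    by (simp add: fps_form_def quad_form_def sum.atMost_Suc_shift del: sum.atMost_Suc)
qed

lemma fps_form_inl_inr: "fps_form n v (fps_inl f * fps_inr f) = (\<Sum>i\<le>n. v i * f $ i)^2"
  by (simp add: fps_form_def quad_form_def fps_inl_mult_nth fps_inr_def power2_eq_square sum_product mult_ac)

lemma fps_form_const: "fps_form n v (fps_inl (fps_const b)) = b * (v 0)^2"
proof -
  have "fps_form n v (fps_inl (fps_const b)) = (\<Sum>i\<le>n. \<Sum>j\<le>n. if j = 0 then if i = 0 then b * (v 0)^2 else 0 else 0)"
    unfolding fps_form_def quad_form_def
    by (intro sum.cong refl) (auto simp: fps_inl_def power2_eq_square)
  then show ?thesis by simp
qed

section \<open>The separatrix series is a Stieltjes series\<close>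

text \<open>A purely formal setting without convergence: \<open>w\<close> stands for
  \<open>- h\<close> expanded in \<open>x = 1 - u\<close>, and \<open>c = 1/r - r\<close>.\<close>

locale separatrix_series =
  fixes c r :: real and w :: "real fps"
  assumes r_pos: "0 < r" and r_eq: "r\<^sup>2 + c * r = 1"
    and w_0: "w $ 0 = 0" and w_1: "w $ 1 = r"
    and ode: "w * fps_deriv w = fps_X - fps_X\<^sup>2 - fps_const c * w"
begin

definition "S = fps_shift 1 (fps_const r - fps_deriv w)"
definition "V = fps_const r - fps_shift 1 w"
definition "W = fps_shift 1 V"

lemma deriv_w: "fps_deriv w = fps_const r - fps_X * S"
  using w_1 by (auto simp: fps_eq_iff S_def w_0 )

lemma w_eq: "w = fps_X * (fps_const r - V)"
  by (auto simp: fps_eq_iff V_def w_0)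

lemma V_eq: "V = fps_X * W"
  using w_1 by (auto simp: fps_eq_iff W_def V_def)

text \<open>Comparing \<open>w = x (r - V)\<close> with \<open>w' = r - x S\<close>, integration
  divides the coefficient by the new degree \<open>i + 2\<close>. This is the origin of the Cauchy
  matrices.\<close>

lemma V_nth: "V $ (i + 1) = S $ i / real (i + 2)"
  using w_1 by (simp add: V_def S_def field_simps)

lemma W_nth: "W $ i = S $ i / real (i + 2)"
  using V_nth[of i] by (simp add: W_def)

lemma w_nth: "w $ (i + 2) = - S $ i / real (i + 2)"
  using V_nth[of i] by (simp add: V_def)

text \<open>Differentiate \<open>ode\<close> once and insert \<open>w' = r - x S\<close>. The
  constant terms cancel by \<open>r_eq\<close>, and a factor \<open>x\<close> can be
  removed.\<close>

lemma flow_S: "w * fps_deriv S = 2 - fps_const (c + 3 * r) * S + fps_X * S\<^sup>2 + V * S"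
proof -
  let ?c = "fps_const c" and ?r = "fps_const r"
  define S' where "S' = fps_deriv S"
  have "fps_deriv (w * fps_deriv w) = fps_deriv (fps_X - fps_X\<^sup>2 - ?c * w)"
    by (simp only: ode)
  then have 1: "w * (- (S + fps_X * S')) + (?r - fps_X * S) * (?r - fps_X * S) = 1 - 2 * fps_X - ?c * (?r - fps_X * S)"
    by (simp add: deriv_w S'_def power2_eq_square algebra_simps numeral_fps_const)
  have 2: "?r * ?r + ?c * ?r = 1"
    using r_eq by (simp add: power2_eq_square)
  have 3: "fps_X * (w * S' ) = fps_X * (2 - (?c + 3 * ?r) * S + fps_X * S\<^sup>2 + V * S)"
    using 1 2 w_eq by algebra
  have "fps_const (c + 3 * r) = ?c + 3 * ?r" by (simp add: numeral_fps_const)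
  with 3 show ?thesis by (simp add: S'_def)
qed

lemma flow_XS: "w * fps_deriv (fps_X * S) = w * S + fps_X * (w * fps_deriv S)"
  by (simp add: algebra_simps)

abbreviation "L1 \<equiv> div_diff (fps_X * S)"
abbreviation "L2 \<equiv> div_diff S"

text \<open>Lyapunov equation for the Hankel matrix of \<open>S\<close>, with
  \<open>\<kappa> = c + 3 * r\<close>. After multiplication by \<open>(x - y)^2\<close> all divided
  differences are gone and a polynomial identity in \<open>x\<close>, \<open>y\<close> and the
  values of \<open>S\<close> and \<open>W\<close> remains.\<close>

lemma flow_L1:
  "fps_flow w L1 = (fps_inl (fps_X * S + V - fps_const (c + 3 * r)) + fps_inr (fps_X * S + V)) * L1
     + (fps_inl (fps_const 2) + fps_inl fps_X * fps_inr fps_X * (div_diff W * L1))"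
proof -
  let ?c = "fps_inl (fps_const c)" and ?r = "fps_inl (fps_const r)"
  define x y where "x = fps_inl fps_X" and "y = fps_inr fps_X"
  define s1 s2 w1 w2 where "s1 = fps_inl S" "s2 = fps_inr S" "w1 = fps_inl W" "w2 = fps_inr W"
  note defs = x_def[symmetric] y_def[symmetric] s1_s2_w1_w2_def[symmetric]
  note hom = fps_inl_add fps_inl_mult fps_inl_diff fps_inr_add fps_inr_mult fps_inr_diff fps_inr_const
  have cr: "fps_inl (fps_const (c + 3 * r)) = ?c + 3 * ?r" by (simp add: numeral_fps_const fps_inl_def)
  have two: "fps_inl 2 = 2" "fps_inr 2 = 2" "fps_inl (fps_const 2) = 2"
    by (simp_all add: numeral_fps_const fps_inl_def fps_inr_def fps_eq_iff)
  have XS: "w * fps_deriv (fps_X * S) = fps_X * (fps_const r - fps_X * W) * S + 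
      fps_X * (2 - fps_const (c + 3 * r) * S + fps_X * S * S + fps_X * W * S)"
    unfolding flow_XS flow_S by (subst w_eq) (simp add: V_eq power2_eq_square)
  have dL: "(x - y) * L1 = x * s1 - y * s2"
    using div_diff_eq[of "fps_X * S"] by (simp add: hom defs)
  have dW: "(x - y) * div_diff W = w1 - w2"
    using div_diff_eq[of W] by (simp add: hom defs)
  have flow_d: "fps_flow w (x - y) = x * (?r - x * w1) - y * (?r - y * w2)"
    unfolding x_def y_def fps_flow_diff fps_flow_inl fps_flow_inr
    by (subst (1 2) w_eq) (simp add: hom V_eq defs)
  have "fps_flow w ((x - y) * L1) = fps_inl (w * fps_deriv (fps_X * S)) - fps_inr (w * fps_deriv (fps_X * S))"
    unfolding dL unfolding x_def y_def s1_s2_w1_w2_def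
    by (simp only: fps_flow_diff fps_flow_inl fps_flow_inr flip: fps_inl_mult fps_inr_mult)
  also have "\<dots> = (x * (?r - x * w1) * s1 + x * (2 - (?c + 3 * ?r) * s1 + x * s1 * s1 + x * w1 * s1)) -
     (y * (?r - y * w2) * s2 + y * (2 - (?c + 3 * ?r) * s2 + y * s2 * s2 + y * w2 * s2))"
    unfolding XS by (simp only: hom cr two defs)
  finally have *: "fps_flow w (x - y) * L1 + (x - y) * fps_flow w L1 = \<dots>"
    by (simp add: fps_flow_mult)
  have "(x - y) * ((x - y) * fps_flow w L1) = (x - y) * ((x - y) *
     ((x * s1 + x * w1 - (?c + 3 * ?r) + (y * s2 + y * w2)) * L1 + (2 + x * y * (div_diff W * L1))))"
    using * dL dW flow_d by algebra
  then show ?thesis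
    using inl_X_neq_inr_X by (simp add: V_eq hom cr two defs)
qed

text \<open>The companion equation for the shifted Hankel matrix, with
  \<open>\<kappa> = c + 4 * r\<close>, obtained in the same way.\<close>

lemma flow_L2:
  "fps_flow w L2 = (fps_inl (fps_X * S + V - fps_const (c + 4 * r)) + fps_inr (fps_X * S + V)) * L2
     + (fps_inl S * fps_inr S + div_diff V * L1)"
proof -
  let ?c = "fps_inl (fps_const c)" and ?r = "fps_inl (fps_const r)"
  define x y where "x = fps_inl fps_X" and "y = fps_inr fps_X"
  define s1 s2 v1 v2 where "s1 = fps_inl S" "s2 = fps_inr S" "v1 = fps_inl V" "v2 = fps_inr V"
  note defs = x_def[symmetric] y_def[symmetric] s1_s2_v1_v2_def[symmetric]
  note hom = fps_inl_add fps_inl_mult fps_inl_diff fps_inr_add fps_inr_mult fps_inr_diff fps_inr_const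
  have cr: "fps_inl (fps_const (c + 3 * r)) = ?c + 3 * ?r" "fps_inl (fps_const (c + 4 * r)) = ?c + 4 * ?r"
    by (simp_all add: numeral_fps_const fps_inl_def)
  have two: "fps_inl 2 = 2" "fps_inr 2 = 2" "fps_inl (fps_const 2) = 2"
    by (simp_all add: numeral_fps_const fps_inl_def fps_inr_def fps_eq_iff)
  have dL: "(x - y) * L1 = x * s1 - y * s2"
    using div_diff_eq[of "fps_X * S"] by (simp add: hom defs)
  have dS: "(x - y) * L2 = s1 - s2"
    using div_diff_eq[of S] by (simp add: hom defs)
  have dV: "(x - y) * div_diff V = v1 - v2"
    using div_diff_eq[of V] by (simp add: hom defs)
  have flow_d: "fps_flow w (x - y) = x * (?r - v1) - y * (?r - v2)"
    unfolding x_def y_def fps_flow_diff fps_flow_inl fps_flow_inr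
    by (subst (1 2) w_eq) (simp add: hom defs)
  have "fps_flow w ((x - y) * L2) = fps_inl (w * fps_deriv S) - fps_inr (w * fps_deriv S)"
    unfolding dS unfolding x_def y_def s1_s2_v1_v2_def
    by (simp only: fps_flow_diff fps_flow_inl fps_flow_inr)
  also have "\<dots> = (2 - (?c + 3 * ?r) * s1 + x * (s1 * s1) + v1 * s1) -
     (2 - (?c + 3 * ?r) * s2 + y * (s2 * s2) + v2 * s2)"
    unfolding flow_S power2_eq_square by (simp only: hom cr two defs)
  finally have *: "fps_flow w (x - y) * L2 + (x - y) * fps_flow w L2 = \<dots>"
    by (simp add: fps_flow_mult)
  have "(x - y) * ((x - y) * fps_flow w L2) = (x - y) * ((x - y) *
     ((x * s1 + v1 - (?c + 4 * ?r) + (y * s2 + v2)) * L2 + (s1 * s2 + div_diff V * L1)))"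
    using * dL dS dV flow_d by algebra
  then show ?thesis
    using inl_X_neq_inr_X by (simp add: hom cr two defs)
qed

text \<open>Follows from \<open>r (c + r) = 1\<close>; it makes both constants
  \<open>c + 3 * r\<close> and \<open>c + 4 * r\<close> positive.\<close>

lemma c_plus_pos: "c + r > 0"
proof -
  have "r * (c + r) > 0" using r_eq by (simp add: power2_eq_square algebra_simps)
  then show ?thesis using r_pos by (simp add: zero_less_mult_iff)
qed

text \<open>Simultaneous induction. At order \<open>n\<close> the source term for \<open>L1\<close>
  is the constant 2, which alone settles \<open>n = 0\<close>, plus a product of matrices of order
  \<open>n - 1\<close>. The source term for \<open>L2\<close> then uses \<open>L1\<close> at order
  \<open>n\<close> itself.\<close>

lemma hankel_pos_def: 
  "pos_def n (\<lambda>i j. S $ (i + j)) \<and> pos_def n (\<lambda>i j. S $ (i + j + 1))"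
proof (induction n rule: less_induct)
  case (less n)
  have L1: "L1 $ j $ i = S $ (i + j)" and L2: "L2 $ j $ i = S $ (i + j + 1)" for i j
    by simp_all
  have V: "div_diff V $ j $ i = S $ (i + j) / real (i + j + 2)" for i j
    using V_nth[of "i + j"] by simp
  have W: "div_diff W $ j $ i = S $ (i + j + 1) / real (i + j + 3)" for i j
    using W_nth[of "i + j + 1"] by (simp add: add_ac)
  have a0: "(fps_X * S + V) $ 0 = 0" by (simp add: V_eq)
  have 1: "pos_def n (\<lambda>i j. L1 $ j $ i)"
  proof (rule lyapunov_pos_def[OF flow_L1 w_0 _ a0])
    fix v :: "nat \<Rightarrow> real" assume v: "v n = 1"
    show "0 < fps_form n v (fps_inl (fps_const 2) + fps_inl fps_X * fps_inr fps_X * (div_diff W * L1))"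
    proof (cases n)
      case (Suc m)
      have "0 < fps_form m (\<lambda>i. v (Suc i)) (div_diff W * L1)"
        using v Suc less.IH[of m] pos_def_cauchy[of m "\<lambda>i j. S $ (i + j + 1)" 3]
        unfolding V W L1
        by (intro fps_form_mult_pos[of _ _ _ m]) (auto simp: W L1 simp del: div_diff_nth, simp_all add: add_ac)
      then show ?thesis
        unfolding fps_form_add fps_form_const Suc fps_form_XY_mult by (intro add_nonneg_pos) auto
    qed (use v in \<open>simp add: fps_form_def quad_form_def fps_inl_def\<close>)
  qed (use less r_pos w_1 c_plus_pos in \<open>auto simp: add_ac simp del: of_nat_add\<close>)
  have 2: "pos_def n (\<lambda>i j. L2 $ j $ i)"
  proof (rule lyapunov_pos_def[OF flow_L2 w_0 _ a0])
    fix v :: "nat \<Rightarrow> real" assume v: "v n = 1"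
    have "0 < fps_form n v (div_diff V * L1)"
      using v 1 pos_def_cauchy[of n "\<lambda>i j. S $ (i + j)" 2]
      by (intro fps_form_mult_pos[of _ _ _ n]) (auto simp: V L1 simp del: div_diff_nth, simp_all add: add_ac)
    then show "0 < fps_form n v (fps_inl S * fps_inr S + div_diff V * L1)"
      unfolding fps_form_add fps_form_inl_inr by (intro add_nonneg_pos) auto
  qed (use less r_pos w_1 c_plus_pos in \<open>auto simp: add_ac simp del: of_nat_add\<close>)
  from 1 2 show ?case by simp
qed

text \<open>Depending on the parity of \<open>n\<close>, this is a diagonal entry of one of the two
  Hankel matrices.\<close>

lemma S_pos: "S $ n > 0"
proof (cases "even n")
  case True
  then obtain k where "n = k + k" by (metis evenE mult_2)
  then show ?thesis using pos_def_diag[OF conjunct1[OF hankel_pos_def[of k]], of k] by simp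
next
  case False
  then obtain k where "n = k + k + 1" by (metis oddE mult_2)
  then show ?thesis using pos_def_diag[OF conjunct2[OF hankel_pos_def[of k]], of k] by simp
qed

lemma w_neg: "w $ (n + 2) < 0"
  unfolding w_nth using S_pos[of n] by (intro divide_neg_pos) auto

end

section \<open>Diagonal Pade approximants of a Stieltjes series\<close>

lemma fps_div_mult_self:
  fixes p q :: "real poly"
  assumes "poly q 0 \<noteq> 0"
  shows "fps_of_poly p / fps_of_poly q * fps_of_poly q = fps_of_poly p"
proof -
  have "fps_of_poly q dvd 1" using assms by (simp add: poly_0_coeff_0)
  then have "fps_of_poly q dvd fps_of_poly p" by (rule unit_imp_dvd)
  then show ?thesis by simp
qed

lemma poly_eqI_cutoff:
  fixes p q :: "real poly"
  assumes "degree p \<le> n" "degree q \<le> n" "\<And>k. k \<le> n \<Longrightarrow> coeff p k = coeff q k"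
  shows "p = q"
  using assms by (intro poly_eqI) (metis coeff_eq_0 leI le_less_trans)

text \<open>The polynomial \<open>p1 * q2 - p2 * q1\<close> has degree at most \<open>2 * m\<close>
  and no coefficients up to that degree, hence is zero. By coprimality the pairs differ by a unit
  factor, so the quotients agree even at zeros of the denominators, as the equality of functions in
  \<open>pade\<close> requires.\<close>

lemma is_pade_unique:
  assumes 1: "is_pade m F p1 q1" and 2: "is_pade m F p2 q2"
  shows "poly p1 x / poly q1 x = poly p2 x / poly q2 x"
proof -
  define H1 H2 where "H1 = fps_of_poly p1 / fps_of_poly q1" "H2 = fps_of_poly p2 / fps_of_poly q2"
  have H: "H1 * fps_of_poly q1 = fps_of_poly p1" "H2 * fps_of_poly q2 = fps_of_poly p2"
    using 1 2 by (simp_all add: is_pade_def H1_H2_def fps_div_mult_self)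
  have HH: "(H1 - H2) $ k = 0" if "k \<le> 2 * m" for k
    using 1 2 that by (simp add: is_pade_def H1_H2_def)
  have "fps_of_poly (p1 * q2) - fps_of_poly (p2 * q1) = (H1 - H2) * fps_of_poly (q1 * q2)"
    by (simp add: fps_of_poly_mult flip: H) (simp add: algebra_simps)
  moreover have "((H1 - H2) * fps_of_poly (q1 * q2)) $ k = 0" if "k \<le> 2 * m" for k
    unfolding fps_mult_nth using HH that by (intro sum.neutral) auto
  ultimately have "(fps_of_poly (p1 * q2) - fps_of_poly (p2 * q1)) $ k = 0" if "k \<le> 2 * m" for k
    using that by simp
  then have "coeff (p1 * q2) k = coeff (p2 * q1) k" if "k \<le> 2 * m" for k
    using that by simp
  then have eq: "p1 * q2 = p2 * q1"
    using 1 2 by (intro poly_eqI_cutoff[where n = "2 * m"] order.trans[OF degree_mult_le])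
      (auto simp: is_pade_def)
  have cop: "coprime q1 p1" "coprime q2 p2" and nz: "q1 \<noteq> 0" "q2 \<noteq> 0"
    using 1 2 by (auto simp: is_pade_def coprime_commute)
  have "q1 dvd p1 * q2" "q2 dvd p2 * q1" using eq by (metis dvd_triv_right)+
  then have "q1 dvd q2" "q2 dvd q1" using cop by (simp_all add: coprime_dvd_mult_right_iff)
  then obtain s t where st: "q2 = q1 * s" "q1 = q2 * t" by (meson dvdE)
  then have "s * t = 1" using nz by (metis mult.assoc mult.right_neutral mult_cancel_left)
  then have "poly s x * poly t x = 1" by (metis poly_1 poly_mult)
  then have "poly s x \<noteq> 0" by auto
  moreover have "p2 = p1 * s" using eq nz st(1) by (simp add: mult_ac)
  ultimately show ?thesis by (simp add: st(1))
qed

text \<open>Admits pairs with common factors: cancelling the gcd preserves the series, and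
  \<open>poly q x \<noteq> 0\<close> preserves the value at \<open>x\<close>.\<close>

lemma pade_eq:
  assumes deg: "degree p \<le> m" "degree q \<le> m" and q0: "poly q 0 \<noteq> 0"
    and nth: "\<And>k. k \<le> 2 * m \<Longrightarrow> (fps_of_poly p / fps_of_poly q) $ k = F $ k"
    and qx: "poly q x \<noteq> 0"
  shows "pade m F x = poly p x / poly q x"
proof -
  have nz: "q \<noteq> 0" using q0 by auto
  define g where "g = gcd p q"
  obtain p' q' where pq: "p = p' * g" "q = q' * g" "coprime p' q'"
    using gcd_coprime_exists[of p q] nz unfolding g_def by auto
  define H where "H = fps_of_poly p / fps_of_poly q"
  have "H * fps_of_poly q' * fps_of_poly g = fps_of_poly p' * fps_of_poly g"
    using fps_div_mult_self[OF q0, of p] by (simp add: pq fps_of_poly_mult H_def mult_ac)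
  then have "H * fps_of_poly q' = fps_of_poly p'" using nz pq by auto
  then have H: "fps_of_poly p' / fps_of_poly q' = H"
    using nz pq by (metis fps_of_poly_0 fps_of_poly_eq_iff mult_zero_left nonzero_mult_div_cancel_right)
  have g: "g \<noteq> 0" "degree (a * g) = degree a + degree g" if "a \<noteq> 0" for a
    using that nz by (auto simp: g_def degree_mult_eq)
  have "degree p' \<le> m"
    using deg(1) g(2)[of p'] pq(1) by (cases "p' = 0") auto
  moreover have "degree q' \<le> m"
    using deg(2) g(2)[of q'] pq(2) by (cases "q' = 0") auto
  moreover have "poly q' 0 \<noteq> 0"
    using q0 unfolding pq(2)[THEN arg_cong, of "\<lambda>q. poly q 0"] by auto
  ultimately have pade': "is_pade m F p' q'"
    using pq(3) nth unfolding is_pade_def H unfolding H_def by blast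
  have "pade m F = (\<lambda>x. poly p' x / poly q' x)"
    unfolding pade_def
  proof (rule the_equality)
    show "\<exists>p q. is_pade m F p q \<and> (\<lambda>x. poly p' x / poly q' x) = (\<lambda>x. poly p x / poly q x)"
      using pade' by blast
  qed (use is_pade_unique[OF _ pade'] in blast)
  moreover have "poly g x \<noteq> 0"
    using qx unfolding pq(2)[THEN arg_cong, of "\<lambda>q. poly q x"] by auto
  moreover have "poly p x = poly p' x * poly g x" "poly q x = poly q' x * poly g x"
    using pq(1,2)[THEN arg_cong, of "\<lambda>q. poly q x"] by simp_all
  ultimately show ?thesis by simp
qed

definition orthogonal_vec :: "real fps \<Rightarrow> nat \<Rightarrow> nat \<Rightarrow> real" where
  "orthogonal_vec S m = (SOME v. v m = 1 \<and> (\<forall>i<m. (\<Sum>j\<le>m. S $ (i + j) * v j) = 0))"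

text \<open>These are the strict positivity conditions of the Stieltjes moment problem; no measure
  is constructed.\<close>

locale stieltjes_series =
  fixes S :: "real fps"
  assumes hankel_0: "pos_def n (\<lambda>i j. S $ (i + j))"
    and hankel_1: "pos_def n (\<lambda>i j. S $ (i + j + 1))"
begin

lemma orthogonal_vec:
  "orthogonal_vec S m m = 1" "i < m \<Longrightarrow> (\<Sum>j\<le>m. S $ (i + j) * orthogonal_vec S m j) = 0"
  using someI_ex[OF pos_def_orthogonal[of "\<lambda>i j. S $ (i + j)" m, OF _ hankel_0]]
  unfolding orthogonal_vec_def by (auto simp: add.commute)

text \<open>
  With \<open>Q\<close> the monic orthogonal polynomial of degree \<open>m\<close> for the moment functional \<open>\<L>(t\<^sup>k) = S\<^sub>k\<close>,
  \<open>den m = x\<^sup>m Q(1/x)\<close>, \<open>num m / den m\<close> is the Pade approximant of type \<open>(m - 1, m)\<close> of \<open>S\<close>, and the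
  error series have the coefficients \<open>rem1 m $ k = \<L>(t\<^sup>k Q)\<close> and \<open>rem2 m $ k = \<L>(t\<^sup>k Q\<^sup>2)\<close>. The latter are
  nonnegative, so the denominators have no zeros on \<open>(0, 1)\<close>.
\<close>

definition den :: "nat \<Rightarrow> real poly" where
  "den m = (\<Sum>k\<le>m. monom (orthogonal_vec S m (m - k)) k)"

definition num :: "nat \<Rightarrow> real poly" where
  "num m = (\<Sum>k<m. monom ((fps_of_poly (den m) * S) $ k) k)"

definition rem1 :: "nat \<Rightarrow> real fps" where
  "rem1 m = Abs_fps (\<lambda>k. \<Sum>j\<le>m. orthogonal_vec S m j * S $ (k + j))"

definition rem2 :: "nat \<Rightarrow> real fps" where
  "rem2 m = Abs_fps (\<lambda>k. quad_form m (\<lambda>i j. S $ (k + i + j)) (orthogonal_vec S m))"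

lemma coeff_den: "coeff (den m) k = (if k \<le> m then orthogonal_vec S m (m - k) else 0)"
  by (simp add: den_def coeff_sum)

lemma coeff_num: "coeff (num m) k = (if k < m then (fps_of_poly (den m) * S) $ k else 0)"
  by (simp add: num_def coeff_sum)

lemma degree_den: "degree (den m) \<le> m"
  by (rule degree_le) (simp add: coeff_den)

lemma degree_num: "degree (num m) \<le> m - 1"
  by (rule degree_le) (auto simp: coeff_num)

lemma coeff_den_0: "coeff (den m) 0 = 1"
  by (simp add: coeff_den orthogonal_vec)

lemma den_mult_nth: 
  assumes "n \<ge> m"
  shows "(fps_of_poly (den m) * F) $ n = (\<Sum>j\<le>m. orthogonal_vec S m j * F $ (n - m + j))"
proof -
  have "(fps_of_poly (den m) * F) $ n = (\<Sum>k\<le>m. orthogonal_vec S m (m - k) * F $ (n - k))"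
    unfolding fps_mult_nth fps_of_poly_nth coeff_den using assms
    by (intro sum.mono_neutral_cong_right) auto
  also have "\<dots> = (\<Sum>j\<le>m. orthogonal_vec S m j * F $ (n - m + j))"
    using assms by (intro sum.reindex_bij_witness[of _ "\<lambda>j. m - j" "\<lambda>j. m - j"]) auto
  finally show ?thesis .
qed

lemma rem1_nth_less: "k < m \<Longrightarrow> rem1 m $ k = 0"
  using orthogonal_vec(2)[of k m] by (simp add: rem1_def mult.commute)

lemma den_mult_S: "fps_of_poly (den m) * S = fps_of_poly (num m) + fps_X ^ m * rem1 m"
  by (rule fps_ext) (auto simp: coeff_num fps_X_power_mult_nth den_mult_nth rem1_def)

text \<open>Together with \<open>den_mult_S\<close> this is the error formula of Gauss quadrature,
  \<open>S - num m / den m = x^(2 m) * rem2 m / (den m)^2\<close>.\<close>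

lemma den_mult_rem1: "fps_of_poly (den m) * rem1 m = fps_X ^ m * rem2 m"
proof (rule fps_ext)
  fix n
  show "(fps_of_poly (den m) * rem1 m) $ n = (fps_X ^ m * rem2 m) $ n"
  proof (cases "n < m")
    case True
    then show ?thesis by (simp add: fps_X_power_mult_nth fps_mult_nth rem1_nth_less)
  next
    case False
    then show ?thesis
      by (simp add: den_mult_nth fps_X_power_mult_nth rem2_def rem1_def quad_form_def
            sum_distrib_left mult_ac add_ac)
  qed
qed

lemma rem2_nonneg: "rem2 m $ k \<ge> 0"
proof -
  define l where "l = k div 2"
  \<comment> \<open>These are the coefficients of \<open>t^l Q\<close>. According to the parity of
    \<open>k\<close>, \<open>rem2 m $ k\<close> is the moment functional of \<open>(t^l Q)^2\<close>
    or of \<open>t (t^l Q)^2\<close>.\<close>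
  define u where "u = (\<lambda>i. if i < l then 0 else orthogonal_vec S m (i - l))"
  have shift: "quad_form (l + m) A u = quad_form m (\<lambda>i j. A (l + i) (l + j)) (orthogonal_vec S m)" for A
  proof -
    have *: "(\<Sum>i\<le>l + m. (if i < l then 0 else f (i - l))) = (\<Sum>i\<le>m. f i)" for f :: "nat \<Rightarrow> real"
    proof -
      have "(\<Sum>i\<le>l + m. (if i < l then 0 else f (i - l))) = (\<Sum>i\<in>{l..l + m}. f (i - l))"
        by (intro sum.mono_neutral_cong_right) auto
      also have "\<dots> = (\<Sum>i\<le>m. f i)"
        by (intro sum.reindex_bij_witness[of _ "\<lambda>i. i + l" "\<lambda>i. i - l"]) auto
      finally show ?thesis .
    qed
    have "quad_form (l + m) A u = (\<Sum>i\<le>l + m. if i < l then 0 else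
        (\<Sum>j\<le>l + m. if j < l then 0 else orthogonal_vec S m (i - l) * orthogonal_vec S m (j - l) * 
             A (l + (i - l)) (l + (j - l))))"
      unfolding quad_form_def by (intro sum.cong refl) (auto simp: u_def intro!: sum.cong)
    also have "\<dots> = (\<Sum>i\<le>m. \<Sum>j\<le>l + m. if j < l then 0 else orthogonal_vec S m i * orthogonal_vec S m (j - l) * 
             A (l + i) (l + (j - l)))"
      by (rule *)
    also have "\<dots> = (\<Sum>i\<le>m. \<Sum>j\<le>m. orthogonal_vec S m i * orthogonal_vec S m j * A (l + i) (l + j))"
      by (intro sum.cong refl *)
    finally show ?thesis by (simp add: quad_form_def)
  qed
  show ?thesis
  proof (cases "even k")
    case True
    then have "k = l + l" by (auto simp: l_def)
    with pos_def_nonneg[OF hankel_0, of "l + m" u] show ?thesis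
      unfolding shift by (simp add: rem2_def add_ac)
  next
    case False
    then have "k = l + l + 1" by (auto simp: l_def elim: oddE)
    with pos_def_nonneg[OF hankel_1, of "l + m" u] show ?thesis
      unfolding shift by (simp add: rem2_def add_ac)
  qed
qed

lemma rem2_0_pos: "rem2 m $ 0 > 0"
  using pos_defD[OF hankel_0[of m], of m "orthogonal_vec S m"]
  by (simp add: rem2_def orthogonal_vec)

lemma rem1_lead: "rem1 m $ m = rem2 m $ 0"
proof -
  have "(fps_of_poly (den m) * rem1 m) $ m = rem1 m $ m"
  proof -
    have "(fps_of_poly (den m) * rem1 m) $ m = (\<Sum>k=0..m. if k = 0 then rem1 m $ m else 0)"
      unfolding fps_mult_nth by (intro sum.cong refl) (auto simp: rem1_nth_less coeff_den_0)
    then show ?thesis by simp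
  qed
  then show ?thesis by (simp add: den_mult_rem1 fps_X_power_mult_nth)
qed

lemma rem1_conv_shift: "rem1 m = fps_X ^ m * fps_shift m (rem1 m)"
  by (rule fps_ext) (auto simp: fps_X_power_mult_nth rem1_nth_less)

text \<open>Both quotients approximate \<open>S\<close> so well that no terms below degree
  \<open>2 * m\<close> occur, and the degree is at most \<open>2 * m\<close>. The surviving
  coefficient is \<open>rem1 m $ m\<close>, since \<open>den (Suc m)\<close> has constant term
  1.\<close>

lemma cross_difference:
  assumes "m \<ge> 1"
  shows "num (Suc m) * den m - num m * den (Suc m) = monom (rem2 m $ 0) (2 * m)"
proof (rule poly_eqI_cutoff[where n = "2 * m"])
  show "degree (num (Suc m) * den m - num m * den (Suc m)) \<le> 2 * m"
    using degree_num[of m] degree_num[of "Suc m"] degree_den[of m] degree_den[of "Suc m"] assms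
    by (intro degree_diff_le order.trans[OF degree_mult_le]) auto
  show "degree (monom (rem2 m $ 0) (2 * m)) \<le> 2 * m" by (rule degree_monom_le)
  define g h where "g = fps_shift m (rem1 m)" and "h = fps_shift (Suc m) (rem1 (Suc m))"
  let ?q = "fps_of_poly (den m)" and ?q' = "fps_of_poly (den (Suc m))"
  have S: "?q * S = fps_of_poly (num m) + fps_X ^ m * (fps_X ^ m * g)"
    "?q' * S = fps_of_poly (num (Suc m)) + fps_X ^ Suc m * (fps_X ^ Suc m * h)"
    unfolding g_def h_def by (subst rem1_conv_shift[symmetric], rule den_mult_S)+
  define X1 X2 :: "real fps" where "X1 = fps_X ^ m" "X2 = fps_X ^ Suc m"
  have "fps_of_poly (num (Suc m) * den m - num m * den (Suc m)) =
      fps_X ^ m * (fps_X ^ m * g) * ?q' - fps_X ^ Suc m * (fps_X ^ Suc m * h) * ?q"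
    unfolding fps_of_poly_diff fps_of_poly_mult using S
    unfolding X1_X2_def[symmetric] by algebra
  also have "\<dots> = fps_X ^ (2 * m) * (g * ?q' - fps_X\<^sup>2 * (h * ?q))"
    unfolding mult_2 power_add power_Suc power2_eq_square by (simp add: algebra_simps)
  finally show "coeff (num (Suc m) * den m - num m * den (Suc m)) k = coeff (monom (rem2 m $ 0) (2 * m)) k"
    if "k \<le> 2 * m" for k
    using that
    by (cases "k = 2 * m")
       (auto simp: fps_eq_iff fps_X_power_mult_nth coeff_den_0 g_def rem1_lead power2_eq_square mult.assoc)
qed

lemma poly_cross_difference:
  assumes "m \<ge> 1"
  shows "poly (num (Suc m)) x * poly (den m) x - poly (num m) x * poly (den (Suc m)) x = 
    rem2 m $ 0 * x ^ (2 * m)"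
  using arg_cong[OF cross_difference[OF assms], of "\<lambda>p. poly p x"] by (simp add: poly_monom)

section \<open>Signs on (0, 1) for a series with radius of convergence at least 1\<close>

context
  assumes radius: "fps_conv_radius S \<ge> 1"
begin

lemma radius_rem1: "fps_conv_radius (rem1 m) \<ge> 1"
proof -
  have "rem1 m = fps_shift m (fps_of_poly (den m) * S - fps_of_poly (num m))"
    by (rule fps_ext) (simp add: den_mult_S fps_X_power_mult_nth)
  then have "fps_conv_radius (rem1 m) = fps_conv_radius (fps_of_poly (den m) * S - fps_of_poly (num m))"
    by simp
  moreover have "1 \<le> fps_conv_radius (fps_of_poly (den m) * S)"
    by (rule order.trans[OF _ fps_conv_radius_mult]) (simp add: radius)
  then have "1 \<le> fps_conv_radius (fps_of_poly (den m) * S - fps_of_poly (num m))"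
    by (intro order.trans[OF _ fps_conv_radius_diff]) simp
  ultimately show ?thesis by simp
qed

lemma radius_rem2: "fps_conv_radius (rem2 m) \<ge> 1"
proof -
  have "rem2 m = fps_shift m (fps_of_poly (den m) * rem1 m)"
    by (rule fps_ext) (simp add: den_mult_rem1 fps_X_power_mult_nth)
  then have "fps_conv_radius (rem2 m) = fps_conv_radius (fps_of_poly (den m) * rem1 m)"
    by simp
  moreover have "1 \<le> fps_conv_radius (fps_of_poly (den m) * rem1 m)"
    by (rule order.trans[OF _ fps_conv_radius_mult]) (simp add: radius_rem1)
  ultimately show ?thesis by simp
qed

context
  fixes x :: real
  assumes x: "0 < x" "x < 1"
begin

lemma x_less_radius: "fps_conv_radius F \<ge> 1 \<Longrightarrow> ereal (norm x) < fps_conv_radius F"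
  by (rule less_le_trans[of _ 1]) (use x in simp_all)

lemma rem2_eval_pos: "eval_fps (rem2 m) x > 0"
proof -
  have "summable (\<lambda>n. rem2 m $ n * x ^ n)"
    using x_less_radius[OF radius_rem2] by (rule summable_fps)
  moreover have "0 < rem2 m $ 0 * x ^ 0" using rem2_0_pos by simp
  ultimately show ?thesis
    unfolding eval_fps_def using rem2_nonneg x by (intro suminf_pos2[where i = 0]) auto
qed

lemma den_mult_rem1_eval: "poly (den m) x * eval_fps (rem1 m) x = x ^ m * eval_fps (rem2 m) x"
  using arg_cong[OF den_mult_rem1[of m], of "\<lambda>f. eval_fps f x"]
    x_less_radius[OF radius_rem1, of m] x_less_radius[OF radius_rem2, of m]
  by (simp add: eval_fps_mult)

lemma den_mult_S_eval: "poly (den m) x * eval_fps S x = poly (num m) x + x ^ m * eval_fps (rem1 m) x"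
proof -
  have "ereal (norm x) < fps_conv_radius (fps_X ^ m * rem1 m)"
    by (intro x_less_radius order.trans[OF _ fps_conv_radius_mult]) (simp add: radius_rem1)
  then show ?thesis
  using arg_cong[OF den_mult_S[of m], of "\<lambda>f. eval_fps f x"]
    x_less_radius[OF radius_rem1, of m] x_less_radius[OF radius]
  by (simp add: eval_fps_mult eval_fps_add)
qed

lemma den_nonzero: "poly (den m) x \<noteq> 0"
  using den_mult_rem1_eval[of m] rem2_eval_pos[of m] x by auto

end

text \<open>The value at 0 is 1 and there are no zeros on (0, 1), so the intermediate value theorem
  applies.\<close>

lemma den_pos: 
  assumes "0 < x" "x < 1" shows "poly (den m) x > 0"
proof (rule ccontr)
  assume "\<not> poly (den m) x > 0"
  moreover have "poly (den m) 0 = 1" by (simp add: poly_0_coeff_0 coeff_den_0)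
  ultimately have "\<exists>y\<ge>0. y \<le> x \<and> poly (den m) y = 0"
    using assms by (intro IVT2) (auto intro!: continuous_intros)
  then obtain y where "0 \<le> y" "y \<le> x" "poly (den m) y = 0" by blast
  with den_nonzero[of y m] assms \<open>poly (den m) 0 = 1\<close> show False by (cases "y = 0") auto
qed

lemma rem1_eval_pos:
  assumes "0 < x" "x < 1" shows "eval_fps (rem1 m) x > 0"
proof -
  have "poly (den m) x * eval_fps (rem1 m) x > 0"
    using den_mult_rem1_eval[of x m] rem2_eval_pos[of x m] assms by simp
  then show ?thesis using den_pos[OF assms, of m] by (simp add: zero_less_mult_iff)
qed

end

text \<open>
  The function to be approximated is \<open>1 / (1 - r x S)\<close>, so its approximant \<open>den m / den' r m\<close>
  arises by substituting \<open>num m / den m\<close> for \<open>S\<close>.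
\<close>

definition den' :: "real \<Rightarrow> nat \<Rightarrow> real poly" where
  "den' r m = den m - monom r 1 * num m"

lemma degree_den': "degree (den' r m) \<le> m"
proof -
  have "degree (monom r 1 * num m) \<le> 1 + degree (num m)"
    using degree_mult_le[of "monom r 1" "num m"] degree_monom_le[of r 1] by linarith
  moreover have "num m = 0" if "m = 0" using that by (simp add: num_def)
  ultimately have "degree (monom r 1 * num m) \<le> m"
    using degree_num[of m] by (cases "m = 0") auto
  then show ?thesis
    unfolding den'_def by (intro degree_diff_le degree_den)
qed

text \<open>The error of \<open>num m / den m\<close> starts at \<open>x^(2 m)\<close>. The factor
  \<open>r x\<close> in front of \<open>S\<close> raises this to \<open>x^(2 m + 1)\<close>, which
  is what order \<open>(m, m)\<close> demands.\<close>

lemma pade_eq_den: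
  assumes F: "\<And>k. k \<le> 2 * m \<Longrightarrow> F $ k = G $ k"
    and G: "G * (1 - fps_const r * fps_X * S) = 1"
    and nz: "poly (den' r m) x \<noteq> 0"
  shows "pade m F x = poly (den m) x / poly (den' r m) x"
proof (rule pade_eq)
  show "degree (den m) \<le> m" by (rule degree_den)
  show "degree (den' r m) \<le> m" by (rule degree_den')
  have d0: "coeff (den' r m) 0 = 1" by (simp add: den'_def coeff_den_0 coeff_mult)
  then show d0': "poly (den' r m) 0 \<noteq> 0" by (simp add: poly_0_coeff_0)
  show "poly (den' r m) x \<noteq> 0" by fact
  fix k assume k: "k \<le> 2 * m"
  let ?d = "fps_of_poly (den' r m)" and ?q = "fps_of_poly (den m)"
  define g where "g = fps_shift m (rem1 m)"
  have S: "?q * S = fps_of_poly (num m) + fps_X ^ m * (fps_X ^ m * g)"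
    unfolding g_def by (subst rem1_conv_shift[symmetric], rule den_mult_S)
  have "fps_of_poly (monom r 1) = fps_const r * fps_X" by (simp add: fps_of_poly_monom)
  then have d: "?d = ?q - fps_const r * fps_X * fps_of_poly (num m)"
    by (simp add: den'_def fps_of_poly_diff fps_of_poly_mult)
  define X1 :: "real fps" where "X1 = fps_X ^ m"
  have num: "fps_of_poly (num m) = ?q * S - X1 * (X1 * g)"
    using S by (simp add: X1_def)
  have "G * ?d = ?q * (G * (1 - fps_const r * fps_X * S)) + X1 * X1 * fps_X * (fps_const r * g * G)"
    unfolding d num by (simp add: algebra_simps)
  then have "?q - G * ?d = X1 * X1 * fps_X * (- (fps_const r * g * G))"
    unfolding G by simp
  moreover have "?q / ?d * ?d = ?q" by (rule fps_div_mult_self[OF d0'])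
  ultimately have *: "(?q / ?d - G) * ?d = fps_X ^ (2 * m + 1) * (- (fps_const r * g * G))"
    unfolding X1_def left_diff_distrib mult_2 power_add power_one_right by simp
  have d_inv: "?d * inverse ?d = 1" using d0 by (intro inverse_mult_eq_1') simp
  have "?q / ?d - G = (?q / ?d - G) * ?d * inverse ?d" by (simp add: mult.assoc d_inv)
  also have "\<dots> = fps_X ^ (2 * m + 1) * (- (fps_const r * g * G) * inverse ?d)"
    unfolding * by (simp only: mult.assoc)
  finally have "(?q / ?d - G) $ k = 0"
    using k by (simp only: fps_X_power_mult_nth) simp
  then show "(?q / ?d) $ k = F $ k" using F[OF k] by simp
qed

text \<open>By \<open>den_mult_S_eval\<close>, \<open>den'\<close> exceeds
  \<open>den * (1 - r x S)\<close> by a positive remainder, which gives its sign and the upper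
  bound. Monotonicity in \<open>m\<close> comes from the cross difference.\<close>

lemma pade_inequalities:
  assumes radius: "fps_conv_radius S \<ge> 1" and x: "0 < x" "x < 1" and r: "0 < r"
    and pos: "0 < 1 - r * x * eval_fps S x"
  defines "P \<equiv> \<lambda>m. poly (den m) x / poly (den' r m) x"
  shows "poly (den' r m) x \<noteq> 0"
    and "P m < 1 / (1 - r * x * eval_fps S x)"
    and "1 \<le> m \<Longrightarrow> P m < P (Suc m)"
proof -
  have d: "poly (den' r m) x = poly (den m) x * (1 - r * x * eval_fps S x) + r * x * x ^ m * eval_fps (rem1 m) x" for m
  proof -
    have num: "poly (num m) x = poly (den m) x * eval_fps S x - x ^ m * eval_fps (rem1 m) x"
      using den_mult_S_eval[OF radius x, of m] by simp
    show ?thesis by (simp add: den'_def poly_monom num) (simp add: algebra_simps)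
  qed
  have d_pos: "poly (den' r m) x > 0" for m
    unfolding d using den_pos[OF radius x, of m] rem1_eval_pos[OF radius x, of m] pos r x
    by (intro add_pos_pos mult_pos_pos) auto
  show "poly (den' r m) x \<noteq> 0" using d_pos[of m] by simp
  have "poly (den m) x * (1 - r * x * eval_fps S x) < poly (den' r m) x"
    unfolding d using rem1_eval_pos[OF radius x, of m] r x by simp
  then show "P m < 1 / (1 - r * x * eval_fps S x)"
    unfolding P_def using d_pos[of m] pos by (simp add: field_simps)
  show "P m < P (Suc m)" if "1 \<le> m"
  proof -
    have "poly (den (Suc m)) x * poly (den' r m) x - poly (den m) x * poly (den' r (Suc m)) x
       = r * x * (poly (num (Suc m)) x * poly (den m) x - poly (num m) x * poly (den (Suc m)) x)"
      by (simp add: den'_def poly_monom) (simp add: algebra_simps)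
    also have "\<dots> = r * x * (rem2 m $ 0 * x ^ (2 * m))"
      by (simp only: poly_cross_difference[OF that])
    also have "\<dots> > 0" using rem2_0_pos[of m] r x by simp
    finally show ?thesis
      unfolding P_def using d_pos[of m] d_pos[of "Suc m"] by (simp add: field_simps)
  qed
qed

end

section \<open>Comparison along the heteroclinic orbit\<close>

text \<open>A one-sided identity theorem, needed because the orbit reaches only positive values of
  \<open>x\<close>.\<close>

lemma fps_eq_0_if_eval_right_0:
  fixes F :: "real fps"
  assumes e: "0 < e" and rad: "ereal e \<le> fps_conv_radius F"
    and zero: "\<And>\<xi>. 0 < \<xi> \<Longrightarrow> \<xi> < e \<Longrightarrow> eval_fps F \<xi> = 0"
  shows "F = 0"
proof (rule ccontr)
  assume "F \<noteq> 0"
  define n where "n = subdegree F"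
  define G where "G = fps_shift n F"
  have F: "F = fps_X ^ n * G"
    by (rule fps_ext) (auto simp: G_def fps_X_power_mult_nth n_def)
  have radG: "ereal e \<le> fps_conv_radius G" using rad by (simp add: G_def)
  have G0: "eval_fps G \<xi> = 0" if "0 < \<xi>" "\<xi> < e" for \<xi>
  proof -
    have "ereal (norm \<xi>) < fps_conv_radius G"
      using that by (intro less_le_trans[OF _ radG]) simp
    then have "eval_fps F \<xi> = \<xi> ^ n * eval_fps G \<xi>"
      unfolding F by (simp add: eval_fps_mult)
    then show ?thesis using zero[OF that] that by simp
  qed
  have "isCont (eval_fps G) 0"
    using radG e by (intro continuous_eval_fps) (auto simp: zero_ereal_def intro: less_le_trans[of _ "ereal e"])
  then have "(eval_fps G \<longlongrightarrow> eval_fps G 0) (at_right 0)"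
    by (simp add: isCont_def filterlim_at_split)
  moreover have "eventually (\<lambda>\<xi>. eval_fps G \<xi> = 0) (at_right 0)"
    using G0 e by (auto simp: eventually_at_right_field)
  then have "(eval_fps G \<longlongrightarrow> 0) (at_right 0)" by (rule tendsto_eventually)
  ultimately have "eval_fps G 0 = 0"
    by (rule tendsto_unique[OF trivial_limit_at_right_real])
  then have "F $ n = 0" by (simp add: eval_fps_at_0 G_def)
  then show False using \<open>F \<noteq> 0\<close> by (simp add: n_def)
qed

text \<open>Gronwall's argument with the integrating factor \<open>exp (k * t)\<close>.\<close>

lemma differential_inequality_pos:
  fixes E E' :: "real \<Rightarrow> real"
  assumes "a \<le> b" and "\<And>t. a \<le> t \<Longrightarrow> t \<le> b \<Longrightarrow> (E has_real_derivative E' t) (at t)"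
    and "\<And>t. a \<le> t \<Longrightarrow> t \<le> b \<Longrightarrow> E' t \<ge> - k * E t" and "E a > 0"
  shows "E b > 0"
proof -
  have "E a * exp (k * a) \<le> E b * exp (k * b)"
  proof (rule DERIV_nonneg_imp_nondecreasing[OF \<open>a \<le> b\<close>])
    fix t assume t: "a \<le> t" "t \<le> b"
    have "((\<lambda>t. E t * exp (k * t)) has_real_derivative (E' t + k * E t) * exp (k * t)) (at t)"
      by (rule derivative_eq_intros assms(2)[OF t] refl)+ (simp add: algebra_simps)
    moreover have "(E' t + k * E t) * exp (k * t) \<ge> 0"
      using assms(3)[OF t] by simp
    ultimately show "\<exists>y. ((\<lambda>t. E t * exp (k * t)) has_real_derivative y) (at t) \<and> 0 \<le> y" by blast
  qed
  moreover have "0 < E a * exp (k * a)" using assms(4) by simp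
  ultimately have "0 < E b * exp (k * b)" by linarith
  then show ?thesis by (simp add: zero_less_mult_iff)
qed

lemma first_hitting_time:
  fixes f :: "real \<Rightarrow> real"
  assumes cont: "continuous_on {a..b} f" and "a \<le> b" "f a > 0" "f b \<le> 0"
  obtains s where "a \<le> s" "s \<le> b" "f s = 0" "\<And>t. a \<le> t \<Longrightarrow> t \<le> s \<Longrightarrow> 0 \<le> f t"
proof -
  define A where "A = {a..b} \<inter> f -` {..0}"
  have "closed A" unfolding A_def by (intro continuous_closed_preimage[OF cont]) auto
  moreover have "b \<in> A" using assms by (auto simp: A_def)
  moreover have "bdd_below A" by (auto simp: A_def intro: bdd_belowI[of _ a])
  ultimately have mem: "Inf A \<in> A" and le: "\<And>t. t \<in> A \<Longrightarrow> Inf A \<le> t"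
    by (auto intro: closed_contains_Inf cInf_lower)
  have pos: "f t > 0" if "a \<le> t" "t < Inf A" for t
    using le[of t] that mem by (force simp: A_def)
  have "\<exists>s\<ge>a. s \<le> Inf A \<and> f s = 0"
    using assms mem by (intro IVT2') (auto simp: A_def intro: continuous_on_subset[OF cont])
  then have "f (Inf A) = 0" using pos by (metis less_irrefl order_less_le)
  then show thesis
    using that[of "Inf A"] mem pos by (force simp: A_def order_le_less)
qed

text \<open>Reflected coordinates \<open>x = 1 - u\<close>, \<open>y = - v\<close>: the saddle lies
  at \<open>x = 0\<close>, the node at \<open>x = 1\<close>, and \<open>g(x)\<close> stands for
  \<open>- h(1 - x)\<close>.\<close>

locale orbit_graph =
  fixes c :: real and g x y :: "real \<Rightarrow> real"
  assumes c_nonneg: "0 \<le> c"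
    and x_deriv: "(x has_real_derivative y t) (at t)"
    and y_deriv: "(y has_real_derivative x t - (x t)\<^sup>2 - c * y t) (at t)"
    and x_range: "x t \<in> {0..1}"
    and y_eq: "y t = g (x t)"
    and g_0: "g 0 = 0" and g_1: "g 1 = 0"
    and x_at_bot: "(x \<longlongrightarrow> 0) at_bot" and x_at_top: "(x \<longlongrightarrow> 1) at_top"
begin

lemma isCont_x: "isCont x t" and isCont_y: "isCont y t"
  using x_deriv y_deriv by (blast intro: DERIV_isCont)+

lemma x_hits:
  assumes "0 < \<xi>" "\<xi> < 1"
  obtains t where "x t = \<xi>" "\<And>s. s < t \<Longrightarrow> x s < \<xi>"
proof -
  obtain a where a: "\<And>t. t \<le> a \<Longrightarrow> x t < \<xi>"
    using order_tendstoD(2)[OF x_at_bot assms(1)] by (auto simp: eventually_at_bot_linorder)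
  obtain b where b: "\<And>t. t \<ge> b \<Longrightarrow> \<xi> < x t"
    using order_tendstoD(1)[OF x_at_top assms(2)] by (auto simp: eventually_at_top_linorder)
  have ab: "a \<le> b" using a[of b] b[of b] by force
  define A where "A = {t. \<xi> \<le> x t}"
  have "closed A" unfolding A_def
    by (intro closed_Collect_le continuous_intros) (simp add: continuous_at_imp_continuous_on isCont_x)
  moreover have "b \<in> A" using b[of b] by (simp add: A_def)
  moreover have "a \<le> t" if "t \<in> A" for t
    using a[of t] that by (cases "t \<le> a") (auto simp: A_def)
  then have "bdd_below A" by (rule bdd_belowI)
  ultimately have mem: "Inf A \<in> A" and le: "\<And>t. t \<in> A \<Longrightarrow> Inf A \<le> t"
    by (auto intro: closed_contains_Inf cInf_lower)
  have less: "x t < \<xi>" if "t < Inf A" for t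
    using le[of t] that by (force simp: A_def)
  have "\<not> Inf A \<le> a" using a mem by (force simp: A_def)
  then have "\<exists>s\<ge>a. s \<le> Inf A \<and> x s = \<xi>"
    using a[of a] mem by (intro IVT) (auto simp: A_def isCont_x)
  then have "x (Inf A) = \<xi>" using less by (metis less_irrefl order_less_le)
  then show thesis using that less by blast
qed

text \<open>When \<open>x\<close> first reaches \<xi>, \<open>y\<close> cannot be negative. If it
  vanished, then \<open>y' = \<xi> (1 - \<xi>) > 0\<close> there, so \<open>y\<close> would be
  negative just before and \<open>x\<close> would arrive from above, which contradicts the choice of
  the time.\<close>

lemma g_pos:
  assumes "0 < \<xi>" "\<xi> < 1"
  shows "0 < g \<xi>"
proof (rule ccontr)
  assume "\<not> 0 < g \<xi>"
  obtain t where t: "x t = \<xi>" "\<And>s. s < t \<Longrightarrow> x s < \<xi>"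
    using x_hits[OF assms] by blast
  have "\<not> y t < 0"
  proof
    assume "y t < 0"
    then obtain d where d: "d > 0" "\<And>h. h > 0 \<Longrightarrow> h < d \<Longrightarrow> x t < x (t - h)"
      using DERIV_neg_dec_left[OF x_deriv] by blast
    from d(2)[of "d / 2"] t(2)[of "t - d / 2"] d(1) t(1) show False by simp
  qed
  then have yt: "y t = 0" using \<open>\<not> 0 < g \<xi>\<close> y_eq[of t] t by simp
  have "0 < \<xi> * (1 - \<xi>)" using assms by simp
  then have "0 < x t - (x t)\<^sup>2 - c * y t" by (simp add: t yt power2_eq_square algebra_simps)
  then obtain d where d: "d > 0" "\<And>h. h > 0 \<Longrightarrow> h < d \<Longrightarrow> y (t - h) < y t"
    using DERIV_pos_inc_left[OF y_deriv] by blast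
  have "x (t - d / 2) > x t"
  proof (rule DERIV_neg_imp_decreasing_open[where f = x])
    show "t - d / 2 < t" using d by simp
    fix s assume s: "t - d / 2 < s" "s < t"
    then have "y s < 0" using d(2)[of "t - s"] yt by simp
    then show "\<exists>z. (x has_real_derivative z) (at s) \<and> z < 0" using x_deriv by blast
  qed (simp add: continuous_at_imp_continuous_on isCont_x)
  with t(2)[of "t - d / 2"] t(1) d(1) show False by simp
qed

lemma y_nonneg: "0 \<le> y t"
  using g_pos[of "x t"] x_range[of t] g_0 g_1 unfolding y_eq
  by (cases "x t = 0 \<or> x t = 1") (auto simp: order_le_less)

lemma x_mono: "s \<le> t \<Longrightarrow> x s \<le> x t"
  by (rule DERIV_nonneg_imp_nondecreasing) (use x_deriv y_nonneg in blast)+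

lemma orbit_segment:
  assumes "0 < \<epsilon>" "\<epsilon> \<le> \<xi>" "\<xi> < 1"
  obtains a b where "a \<le> b" "x a = \<epsilon>" "x b = \<xi>"
    "\<And>t. a \<le> t \<Longrightarrow> t \<le> b \<Longrightarrow> 0 < x t \<and> x t < 1 \<and> 0 < y t"
proof -
  have "\<epsilon> < 1" "0 < \<xi>" using assms by auto
  obtain a where a: "x a = \<epsilon>" "\<And>s. s < a \<Longrightarrow> x s < \<epsilon>"
    using x_hits[OF assms(1) \<open>\<epsilon> < 1\<close>] by blast
  obtain b where b: "x b = \<xi>" using x_hits[OF \<open>0 < \<xi>\<close> assms(3)] by blast
  have "a \<le> b" using a(2)[of b] b assms by (cases "b < a") auto
  moreover have "0 < x t \<and> x t < 1 \<and> 0 < y t" if "a \<le> t" "t \<le> b" for t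
    using x_mono[OF that(1)] x_mono[OF that(2)] a b assms g_pos[of "x t"] by (simp add: y_eq)
  ultimately show thesis using that a b by blast
qed

text \<open>Working with \<open>E = f^2 - y^2\<close> avoids dividing by \<open>f\<close>, whose
  sign is not prescribed. Up to the first time with \<open>f = y\<close> the supersolution
  inequality yields \<open>E' \<ge> - c E\<close>, so \<open>E\<close> stays positive and that time
  cannot occur.\<close>

lemma comparison:
  assumes ab: "a \<le> b" and seg: "\<And>t. a \<le> t \<Longrightarrow> t \<le> b \<Longrightarrow> 0 < x t \<and> x t < 1 \<and> 0 < y t"
    and f: "\<And>\<xi>. 0 < \<xi> \<Longrightarrow> \<xi> < 1 \<Longrightarrow> (f has_real_derivative f' \<xi>) (at \<xi>)"
    and super: "\<And>\<xi>. 0 < \<xi> \<Longrightarrow> \<xi> < 1 \<Longrightarrow> \<xi> - \<xi>\<^sup>2 - c * f \<xi> \<le> f \<xi> * f' \<xi>"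
    and start: "f (x a) > y a"
  shows "f (x b) > y b"
proof (rule ccontr)
  assume "\<not> f (x b) > y b"
  have fx: "((\<lambda>t. f (x t)) has_real_derivative f' (x t) * y t) (at t)" if "a \<le> t" "t \<le> b" for t
    using seg[OF that] by (intro DERIV_chain2[OF f x_deriv]) auto
  have cont: "continuous_on {a..b} (\<lambda>t. f (x t) - y t)"
    using fx isCont_y by (intro continuous_intros continuous_at_imp_continuous_on ballI)
      (auto intro: DERIV_isCont)
  obtain s where s: "a \<le> s" "s \<le> b" "f (x s) - y s = 0" "\<And>t. a \<le> t \<Longrightarrow> t \<le> s \<Longrightarrow> 0 \<le> f (x t) - y t"
    using first_hitting_time[OF cont ab] start \<open>\<not> f (x b) > y b\<close> by (auto simp: not_less)
  define E where "E = (\<lambda>t. f (x t) * f (x t) - y t * y t)"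
  define E' where "E' = (\<lambda>t. 2 * (f (x t) * (f' (x t) * y t) - y t * (x t - (x t)\<^sup>2 - c * y t)))"
  have "E s > 0"
  proof (rule differential_inequality_pos[OF \<open>a \<le> s\<close>])
    fix t assume t: "a \<le> t" "t \<le> s"
    then have t': "t \<le> b" using s by simp
    show "(E has_real_derivative E' t) (at t)"
      using DERIV_diff[OF DERIV_mult'[OF fx[OF t(1) t'] fx[OF t(1) t']] DERIV_mult'[OF y_deriv y_deriv]]
      unfolding E_def E'_def by (rule DERIV_cong) (simp add: algebra_simps)
    define d where "d = f (x t) - y t"
    have y: "y t > 0" and x: "0 < x t" "x t < 1" using seg[OF t(1) t'] by auto
    have d: "d \<ge> 0" using s(4)[OF t] by (simp add: d_def)
    \<comment> \<open>The first summand contains the nonnegative defect of the supersolution; the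
      second is controlled by \<open>2 y d \<le> E\<close>.\<close>
    have "E' t = 2 * (y t * (f (x t) * f' (x t) - (x t - (x t)\<^sup>2 - c * f (x t)))) - 2 * (c * (y t * d))"
      by (simp add: E'_def d_def algebra_simps)
    moreover have "y t * (f (x t) * f' (x t) - (x t - (x t)\<^sup>2 - c * f (x t))) \<ge> 0"
      using y super[OF x] by simp
    moreover have "E t = d * d + 2 * (y t * d)"
      by (simp add: E_def d_def algebra_simps)
    then have "2 * (y t * d) \<le> E t" by simp
    then have "c * (2 * (y t * d)) \<le> c * E t" using c_nonneg by (rule mult_left_mono)
    ultimately show "- c * E t \<le> E' t" by simp
  next
    have "y a > 0" using seg[of a] ab by simp
    then have "y a * y a < f (x a) * f (x a)" using start by (intro mult_strict_mono) auto
    then show "0 < E a" by (simp add: E_def)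
  qed
  then show False using s(3) by (simp add: E_def)
qed

end

section \<open>The expansion of the orbit at the saddle\<close>

locale orbit_expansion = orbit_graph +
  fixes w :: "real fps"
  assumes expansion: "g has_fps_expansion w"
begin

lemma expansion_radius:
  obtains e where "0 < e" "e < 1" "ereal e < fps_conv_radius w" "\<And>\<xi>. \<bar>\<xi>\<bar> < e \<Longrightarrow> eval_fps w \<xi> = g \<xi>"
proof -
  obtain d where d: "d > 0" "\<And>\<xi>. \<bar>\<xi>\<bar> < d \<Longrightarrow> eval_fps w \<xi> = g \<xi>"
    using expansion by (auto simp: has_fps_expansion_def eventually_nhds_metric)
  obtain e0 where e0: "0 < e0" "ereal e0 < fps_conv_radius w"
    using expansion ereal_dense2[of 0 "fps_conv_radius w"] by (auto simp: has_fps_expansion_def zero_ereal_def)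
  define e where "e = min (min d e0) (1 / 2)"
  have e: "e \<le> e0" "e \<le> d" "0 < e" "e < 1" using d e0 by (auto simp: e_def)
  then have "ereal e < fps_conv_radius w" by (intro le_less_trans[OF _ e0(2)]) simp
  then show thesis using d e by (intro that[of e]) auto
qed

lemma eval_deriv_w:
  assumes "\<bar>\<xi>\<bar> < e" "ereal e < fps_conv_radius w" "\<And>\<xi>. \<bar>\<xi>\<bar> < e \<Longrightarrow> eval_fps w \<xi> = g \<xi>"
  shows "(g has_real_derivative eval_fps (fps_deriv w) \<xi>) (at \<xi>)"
proof -
  have "ereal (norm \<xi>) < fps_conv_radius w"
    using assms(1) by (intro less_trans[OF _ assms(2)]) simp
  then have "(eval_fps w has_real_derivative eval_fps (fps_deriv w) \<xi>) (at \<xi>)"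
    by (rule has_field_derivative_eval_fps)
  then show ?thesis
    by (rule has_field_derivative_transform_within_open[where S = "{-e<..<e}"]) (use assms in auto)
qed

text \<open>Differentiating \<open>y = g(x)\<close> along the orbit gives the equation at all small
  positive arguments; the one-sided identity theorem lifts it to series.\<close>

lemma formal_ode: "w * fps_deriv w = fps_X - fps_X\<^sup>2 - fps_const c * w"
proof -
  obtain e where e: "0 < e" "e < 1" "ereal e < fps_conv_radius w" "\<And>\<xi>. \<bar>\<xi>\<bar> < e \<Longrightarrow> eval_fps w \<xi> = g \<xi>"
    using expansion_radius by blast
  have rad: "ereal e \<le> fps_conv_radius w" "ereal e \<le> fps_conv_radius (fps_deriv w)"
    using e(3) by (auto intro: order.trans[OF _ fps_conv_radius_deriv])
  have rad1: "ereal e \<le> fps_conv_radius (w * fps_deriv w)"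
    using rad by (intro order.trans[OF _ fps_conv_radius_mult]) simp
  have rad2: "ereal e \<le> fps_conv_radius (fps_const c * w)"
    using rad by (intro order.trans[OF _ fps_conv_radius_mult]) simp
  have rad3: "ereal e \<le> fps_conv_radius (fps_X - fps_X\<^sup>2 :: real fps)"
    by (intro order.trans[OF _ fps_conv_radius_diff]) simp
  have rad4: "ereal e \<le> fps_conv_radius (fps_X - fps_X\<^sup>2 - fps_const c * w)"
    using rad2 rad3 by (intro order.trans[OF _ fps_conv_radius_diff]) simp
  have "w * fps_deriv w - (fps_X - fps_X\<^sup>2 - fps_const c * w) = 0"
  proof (rule fps_eq_0_if_eval_right_0[OF e(1)])
    show "ereal e \<le> fps_conv_radius (w * fps_deriv w - (fps_X - fps_X\<^sup>2 - fps_const c * w))"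
      using rad1 rad4 by (intro order.trans[OF _ fps_conv_radius_diff]) simp
    fix \<xi> assume \<xi>: "0 < \<xi>" "\<xi> < e"
    have "\<xi> < 1" using \<xi> e by simp
    then obtain t where t: "x t = \<xi>" using x_hits[OF \<xi>(1)] by blast
    have "(g has_real_derivative eval_fps (fps_deriv w) \<xi>) (at \<xi>)"
      using \<xi> by (intro eval_deriv_w[OF _ e(3,4)]) auto
    then have "((\<lambda>s. g (x s)) has_real_derivative eval_fps (fps_deriv w) \<xi> * y t) (at t)"
      using t by (intro DERIV_chain2[OF _ x_deriv]) simp
    then have "(y has_real_derivative eval_fps (fps_deriv w) \<xi> * y t) (at t)"
      by (simp add: y_eq[abs_def])
    then have ode: "eval_fps (fps_deriv w) \<xi> * g \<xi> = \<xi> - \<xi>\<^sup>2 - c * g \<xi>"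
      using DERIV_unique[OF _ y_deriv[of t]] t by (simp add: y_eq)
    have less: "ereal (norm \<xi>) < fps_conv_radius F" if "ereal e \<le> fps_conv_radius F" for F :: "real fps"
      using \<xi> by (intro less_le_trans[OF _ that]) simp
    note rads = less[OF rad(1)] less[OF rad(2)] less[OF rad1] less[OF rad2] less[OF rad3] less[OF rad4]
    have "eval_fps (w * fps_deriv w - (fps_X - fps_X\<^sup>2 - fps_const c * w)) \<xi> =
        eval_fps w \<xi> * eval_fps (fps_deriv w) \<xi> - (\<xi> - \<xi>\<^sup>2 - c * eval_fps w \<xi>)"
      using rads by (simp add: eval_fps_diff eval_fps_mult eval_fps_power)
    then show "eval_fps (w * fps_deriv w - (fps_X - fps_X\<^sup>2 - fps_const c * w)) \<xi> = 0"
      using ode e(4)[of \<xi>] \<xi> by (simp add: mult.commute)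
  qed
  then show ?thesis by simp
qed

lemma w_0: "w $ 0 = 0"
proof -
  obtain e where e: "0 < e" "\<And>\<xi>. \<bar>\<xi>\<bar> < e \<Longrightarrow> eval_fps w \<xi> = g \<xi>"
    using expansion_radius by blast
  then show ?thesis using e(2)[of 0] g_0 by (simp add: eval_fps_at_0)
qed

lemma w_1_nonneg: "w $ 1 \<ge> 0"
proof (rule ccontr)
  assume neg: "\<not> w $ 1 \<ge> 0"
  obtain e where e: "0 < e" "e < 1" "ereal e < fps_conv_radius w" "\<And>\<xi>. \<bar>\<xi>\<bar> < e \<Longrightarrow> eval_fps w \<xi> = g \<xi>"
    using expansion_radius by blast
  have "(g has_real_derivative eval_fps (fps_deriv w) 0) (at 0)"
    using e by (intro eval_deriv_w[OF _ e(3,4)]) auto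
  then have "(g has_real_derivative w $ 1) (at 0)" by (simp add: eval_fps_at_0)
  then obtain d where d: "d > 0" "\<And>h. h > 0 \<Longrightarrow> h < d \<Longrightarrow> g 0 > g (0 + h)"
    using DERIV_neg_dec_right neg by (metis not_le)
  define h where "h = min (d / 2) (1 / 2)"
  have "0 < h" "h < d" "h < 1" using d by (auto simp: h_def)
  then show False using d(2)[of h] g_0 g_pos[of h] by simp
qed

text \<open>The linear coefficient satisfies a quadratic equation with roots \<open>r\<close> and
  \<open>- (r + c)\<close>; \<open>w_1_nonneg\<close> excludes the second.\<close>

lemma w_1:
  assumes "0 < r" "r\<^sup>2 + c * r = 1"
  shows "w $ 1 = r"
proof -
  have "(w * fps_deriv w) $ 1 = (fps_X - fps_X\<^sup>2 - fps_const c * w) $ 1"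
    by (simp only: formal_ode)
  then have "(w $ 1)\<^sup>2 = 1 - c * w $ 1"
    using w_0 by (simp add: power2_eq_square)
  then have "(w $ 1 - r) * (w $ 1 + r + c) = 0"
    using assms(2) by (simp add: power2_eq_square algebra_simps)
  moreover have "w $ 1 + r + c > 0" using w_1_nonneg assms(1) c_nonneg by linarith
  ultimately show ?thesis by simp
qed

end

section \<open>The separatrix and its power series\<close>

lemma higher_deriv_has_fps_expansion:
  fixes f :: "real \<Rightarrow> real"
  assumes "f has_fps_expansion F"
  shows "(deriv ^^ k) f 0 = fact k * F $ k"
  using assms
proof (induction k arbitrary: f F)
  case 0
  then have "eval_fps F 0 = f 0"
    by (auto simp: has_fps_expansion_def dest: eventually_nhds_x_imp_x)
  then show ?case by (simp add: eval_fps_at_0)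
next
  case (Suc k)
  have "(deriv ^^ k) (deriv f) 0 = fact k * fps_deriv F $ k"
    by (rule Suc.IH) (rule has_fps_expansion_deriv[OF Suc.prems])
  then show ?case by (simp add: funpow_swap1)
qed

definition fps_truncate :: "nat \<Rightarrow> real fps \<Rightarrow> real poly" where
  "fps_truncate n F = (\<Sum>k\<le>n. monom (F $ k) k)"

lemma coeff_fps_truncate: "coeff (fps_truncate n F) k = (if k \<le> n then F $ k else 0)"
  by (simp add: fps_truncate_def coeff_sum)

lemma poly_fps_truncate: "poly (fps_truncate n F) x = (\<Sum>k\<le>n. F $ k * x ^ k)"
  by (simp add: fps_truncate_def poly_sum poly_monom)

text \<open>The series on the right is the expansion of \<open>- h (1 - x)\<close>, which later
  plays the role of \<open>w\<close>.\<close>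

lemma poly_taylor_poly_reflect:
  assumes "(\<lambda>x. h (1 + x)) has_fps_expansion H"
  shows "poly (taylor_poly n h 1) u = - poly (fps_truncate n (Abs_fps (\<lambda>k. - ((- 1) ^ k * H $ k)))) (1 - u)"
proof -
  have "(deriv ^^ k) h 1 / fact k = H $ k" for k
    using higher_deriv_has_fps_expansion[OF assms, of k] higher_deriv_shift_0[of k h 1]
    by (simp add: o_def)
  then have "poly (taylor_poly n h 1) u = (\<Sum>k\<le>n. H $ k * (u - 1) ^ k)"
    by (simp add: taylor_poly_def poly_sum)
  moreover have "(u - 1) ^ k = (- 1) ^ k * (1 - u) ^ k" for k
    by (simp flip: power_mult_distrib)
  ultimately show ?thesis
    by (simp add: poly_fps_truncate mult_ac sum_negf)
qed

lemma has_fps_expansion_reflect: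
  fixes f :: "real \<Rightarrow> real"
  assumes "f has_fps_expansion F"
  shows "(\<lambda>x. - f (- x)) has_fps_expansion Abs_fps (\<lambda>k. - ((- 1) ^ k * F $ k))"
    (is "_ has_fps_expansion ?G")
proof -
  have "conv_radius (\<lambda>k. - ((- 1) ^ k * F $ k)) = conv_radius (\<lambda>k. F $ k)"
    by (rule conv_radius_cong) (simp add: abs_mult)
  then have rad: "fps_conv_radius ?G = fps_conv_radius F"
    by (simp add: fps_conv_radius_def)
  have F: "fps_conv_radius F > 0" "eventually (\<lambda>x. eval_fps F x = f x) (nhds 0)"
    using assms by (auto simp: has_fps_expansion_def)
  have "eventually (\<lambda>x. x \<in> eball 0 (fps_conv_radius F)) (nhds 0)"
    using F by (intro eventually_nhds_in_open) (auto simp: zero_ereal_def)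
  moreover have "eventually (\<lambda>x. eval_fps F (- x) = f (- x)) (nhds 0)"
    using F(2) unfolding eventually_nhds_metric by (simp add: dist_real_def) (metis abs_minus_cancel)
  ultimately have "eventually (\<lambda>x. eval_fps ?G x = - f (- x)) (nhds 0)"
  proof eventually_elim
    case (elim x)
    have "summable (\<lambda>k. F $ k * (- x) ^ k)"
      using elim by (intro summable_fps) simp
    then have "eval_fps ?G x = - eval_fps F (- x)"
      unfolding eval_fps_def
      by (subst suminf_minus[symmetric]) (auto simp: power_minus[of x] mult_ac)
    with elim show ?case by simp
  qed
  then show ?thesis using F rad by (simp add: has_fps_expansion_def)
qed

sublocale separatrix_series \<subseteq> stieltjes_series S
  by unfold_locales (use hankel_pos_def in blast)+

section \<open>Truncations of the series and the function to be approximated\<close>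

context separatrix_series
begin

lemma w_neg': "k \<ge> 2 \<Longrightarrow> w $ k < 0"
  using w_neg[of "k - 2"] by (simp only: le_add_diff_inverse2)

text \<open>The residual \<rho> of the truncation has nonnegative coefficients: up to degree
  \<open>N\<close> they vanish by \<open>ode\<close>, beyond it they are sums of products of
  nonpositive numbers.\<close>

lemma truncation_supersolution:
  assumes N: "2 \<le> N" and c: "0 \<le> c" and \<xi>: "0 \<le> \<xi>"
  defines "p \<equiv> fps_truncate N w"
  shows "\<xi> - \<xi>\<^sup>2 - c * poly p \<xi> \<le> poly p \<xi> * poly (pderiv p) \<xi>"
proof -
  define \<rho> where "\<rho> = p * pderiv p + smult c p - [:0, 1, - 1:]"
  have p: "coeff p k = (if k \<le> N then w $ k else 0)" for k
    by (simp add: p_def coeff_fps_truncate)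
  have quad: "coeff [:0, 1, - 1:] k = (fps_X - fps_X\<^sup>2 :: real fps) $ k" for k
    by (auto simp: coeff_pCons fps_X_power_nth split: nat.splits)
  have "coeff \<rho> k \<ge> 0" for k
  proof (cases "k \<le> N")
    case True
    have "coeff (p * pderiv p) k = (\<Sum>i\<le>k. w $ i * fps_deriv w $ (k - i))"
      unfolding coeff_mult
    proof (intro sum.cong refl)
      fix i assume "i \<in> {..k}"
      \<comment> \<open>For \<open>i = 0\<close> the partner has index \<open>k + 1\<close>,
        possibly cut off by the truncation; this is harmless because
        \<open>w $ 0 = 0\<close>.\<close>
      then show "coeff p i * coeff (pderiv p) (k - i) = w $ i * fps_deriv w $ (k - i)"
        using True w_0 by (cases "i = 0") (auto simp: p coeff_pderiv)
    qed
    also have "\<dots> = (w * fps_deriv w) $ k"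
      by (simp add: fps_mult_nth atLeast0AtMost)
    finally show ?thesis
      using True by (simp add: \<rho>_def quad ode p del: coeff_pCons)
  next
    case False
    have "coeff p i * coeff (pderiv p) (k - i) \<ge> 0" if "i \<le> k" for i
    proof -
      have *: "coeff p j \<le> 0" if "j \<noteq> 1" for j
        using that w_0 w_neg'[of j] by (cases "j = 0") (auto simp: p)
      \<comment> \<open>The positive linear coefficient is only ever paired with index
        \<open>k > N\<close>, where \<open>p\<close> vanishes.\<close>
      consider "i = 0" | "i = 1" | "i = k" | "i \<noteq> 1" "k - i + 1 \<noteq> 1" using \<open>i \<le> k\<close> by linarith
      then show ?thesis
      proof cases
        case 4
        then show ?thesis using *[of i] *[of "k - i + 1"]
          by (auto simp: coeff_pderiv intro!: mult_nonpos_nonpos simp: mult_le_0_iff)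
      qed (use False N w_0 in \<open>auto simp: p coeff_pderiv\<close>)
    qed
    then have "coeff (p * pderiv p) k \<ge> 0" unfolding coeff_mult by (intro sum_nonneg) auto
    then show ?thesis using False N by (simp add: \<rho>_def quad p del: coeff_pCons)
  qed
  then have "poly \<rho> \<xi> \<ge> 0" using \<xi> by (simp add: poly_altdef sum_nonneg)
  then show ?thesis by (simp add: \<rho>_def power2_eq_square algebra_simps)
qed

text \<open>Inserting \<open>w' = r - x S\<close> into \<open>ode\<close> gives
  \<open>w (c + r - x S) = x (1 - x)\<close>; multiply by \<open>r\<close> and use
  \<open>r (c + r) = 1\<close>.\<close>

lemma w_mult_denominator: "w * (1 - fps_const r * fps_X * S) = fps_const r * fps_X * (1 - fps_X)"
proof -
  have "fps_const r * fps_const r + fps_const c * fps_const r = 1"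
    using r_eq by (simp add: power2_eq_square)
  then show ?thesis using ode deriv_w by algebra
qed

text \<open>The series of \<open>w / (r x (1 - x))\<close>, that is, \<open>R_series\<close> without
  truncation at degree 22.\<close>

definition G where "G = inverse (1 - fps_const r * fps_X * S)"

lemma G_mult: "G * (1 - fps_const r * fps_X * S) = 1"
  unfolding G_def by (rule inverse_mult_eq_1) simp

lemma w_conv_G: "w = fps_const r * fps_X * (1 - fps_X) * G"
  using w_mult_denominator G_mult by algebra

text \<open>The omitted terms start at degree \<open>n + 1\<close>, and dividing by \<open>x\<close>
  moves them to degree \<open>n\<close>.\<close>

lemma truncation_quotient_nth:
  assumes "k < n"
  shows "(fps_of_poly (- fps_truncate n w) / (fps_const r * fps_X * (fps_X - 1))) $ k = G $ k"
    (is "(_ / ?d) $ k = _")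
proof -
  define Z where "Z = fps_shift (Suc n) w"
  define Y where "Y = Z * inverse (fps_const r * (fps_X - 1))"
  have "w = fps_of_poly (fps_truncate n w) + fps_X ^ Suc n * Z"
    by (rule fps_ext) (auto simp: coeff_fps_truncate fps_X_power_mult_nth Z_def simp del: power_Suc)
  then have "fps_of_poly (- fps_truncate n w) = - w + fps_X * (fps_X ^ n * Z)"
    by (simp add: fps_of_poly_uminus) (simp add: algebra_simps)
  also have "- w = ?d * G"
    by (subst w_conv_G) (simp add: algebra_simps)
  finally have "fps_of_poly (- fps_truncate n w) = ?d * G + fps_X * (fps_X ^ n * Z)" .
  moreover have "inverse (fps_const r * (fps_X - 1)) * (fps_const r * (fps_X - 1)) = 1"
    using r_pos by (intro inverse_mult_eq_1) simp
  then have "Z = Y * (fps_const r * (fps_X - 1))"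
    by (simp add: Y_def mult.assoc)
  ultimately have "fps_of_poly (- fps_truncate n w) = ?d * (G + fps_X ^ n * Y)"
    by (simp add: algebra_simps)
  moreover have "?d \<noteq> 0"
  proof
    assume "?d = 0"
    then have "?d $ 1 = 0" by simp
    then show False using r_pos by (simp add: mult.assoc)
  qed
  ultimately have "fps_of_poly (- fps_truncate n w) / ?d = G + fps_X ^ n * Y"
    by (simp add: nonzero_mult_div_cancel_left)
  then show ?thesis using assms by (simp add: fps_X_power_mult_nth)
qed

end

section \<open>Convergence of the series to the orbit on (0, 1)\<close>

locale separatrix_orbit = orbit_expansion c g x y w + separatrix_series c r w
  for c r g x y w
begin

text \<open>Close to the saddle the truncation is larger because all omitted terms are negative;
  \<open>comparison\<close> carries this along the orbit.\<close>

lemma truncation_greater: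
  assumes N: "2 \<le> N" and \<xi>: "0 < \<xi>" "\<xi> < 1"
  shows "g \<xi> < poly (fps_truncate N w) \<xi>"
proof -
  obtain e where e: "0 < e" "e < 1" "ereal e < fps_conv_radius w" "\<And>\<xi>. \<bar>\<xi>\<bar> < e \<Longrightarrow> eval_fps w \<xi> = g \<xi>"
    using expansion_radius by blast
  define \<epsilon> where "\<epsilon> = min (e / 2) \<xi>"
  have \<epsilon>: "0 < \<epsilon>" "\<epsilon> \<le> \<xi>" "\<bar>\<epsilon>\<bar> < e" using e \<xi> by (auto simp: \<epsilon>_def)
  have "ereal (norm \<epsilon>) < fps_conv_radius w"
    using \<epsilon> by (intro less_trans[OF _ e(3)]) simp
  then have sm: "summable (\<lambda>k. w $ k * \<epsilon> ^ k)" by (rule summable_fps)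
  have "(\<Sum>k<Suc N. - (w $ k * \<epsilon> ^ k)) < (\<Sum>k. - (w $ k * \<epsilon> ^ k))"
  proof (rule sum_less_suminf2)
    show "summable (\<lambda>k. - (w $ k * \<epsilon> ^ k))" using sm by (rule summable_minus)
    show "0 \<le> - (w $ k * \<epsilon> ^ k)" if "k \<ge> Suc N" for k
      using w_neg'[of k] that N \<epsilon> by (simp add: mult_le_0_iff)
    show "0 < - (w $ Suc N * \<epsilon> ^ Suc N)"
      using w_neg'[of "Suc N"] N \<epsilon> by (simp add: mult_less_0_iff del: power_Suc)
  qed simp
  then have "eval_fps w \<epsilon> < poly (fps_truncate N w) \<epsilon>"
    using suminf_minus[OF sm] by (simp add: poly_fps_truncate eval_fps_def sum_negf lessThan_Suc_atMost)
  then have start: "g \<epsilon> < poly (fps_truncate N w) \<epsilon>" using e(4)[of \<epsilon>] \<epsilon> by simp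
  obtain a b where ab: "a \<le> b" "x a = \<epsilon>" "x b = \<xi>"
    "\<And>t. a \<le> t \<Longrightarrow> t \<le> b \<Longrightarrow> 0 < x t \<and> x t < 1 \<and> 0 < y t"
    using orbit_segment[OF \<epsilon>(1,2) \<xi>(2)] by blast
  have "y b < poly (fps_truncate N w) (x b)"
  proof (rule comparison[OF ab(1,4)])
    fix \<zeta> :: real assume "0 < \<zeta>" "\<zeta> < 1"
    then show "\<zeta> - \<zeta>\<^sup>2 - c * poly (fps_truncate N w) \<zeta> \<le> poly (fps_truncate N w) \<zeta> * poly (pderiv (fps_truncate N w)) \<zeta>"
      by (intro truncation_supersolution N c_nonneg) simp
    show "(poly (fps_truncate N w) has_real_derivative poly (pderiv (fps_truncate N w)) \<zeta>) (at \<zeta>)"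
      by (rule poly_DERIV)
  qed (use start ab in \<open>simp_all add: y_eq\<close>)
  then show ?thesis using ab by (simp add: y_eq)
qed

text \<open>The truncations stay above \<open>g > 0\<close>, which bounds the partial sums of the
  negated terms from degree 2 on by \<open>r * \<xi>\<close>.\<close>

lemma summable_w:
  assumes "0 < \<xi>" "\<xi> < 1"
  shows "summable (\<lambda>k. w $ k * \<xi> ^ k)"
proof -
  have "summable (\<lambda>k. - (w $ (k + 2) * \<xi> ^ (k + 2)))"
  proof (rule summableI_nonneg_bounded)
    show "0 \<le> - (w $ (k + 2) * \<xi> ^ (k + 2))" for k
      using w_neg'[of "k + 2"] assms by (simp add: mult_le_0_iff del: power_Suc add_2_eq_Suc')
    fix n
    have "0 < poly (fps_truncate (n + 2) w) \<xi>"
      using truncation_greater[of "n + 2" \<xi>] g_pos[of \<xi>] assms by simp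
    also have "\<dots> = (\<Sum>k<n + 3. w $ k * \<xi> ^ k)"
      by (simp add: poly_fps_truncate lessThan_Suc_atMost[symmetric] numeral_3_eq_3)
    also have "\<dots> = r * \<xi> + (\<Sum>k<Suc n. w $ (k + 2) * \<xi> ^ (k + 2))"
      using w_0 w_1 by (simp add: sum.lessThan_Suc_shift numeral_3_eq_3 del: sum.lessThan_Suc)
    finally have "(\<Sum>k<Suc n. - (w $ (k + 2) * \<xi> ^ (k + 2))) \<le> r * \<xi>"
      by (simp only: sum_negf)
    moreover have "0 \<le> - (w $ (n + 2) * \<xi> ^ (n + 2))"
      using w_neg'[of "n + 2"] assms by (simp add: mult_le_0_iff del: power_Suc add_2_eq_Suc')
    ultimately show "(\<Sum>k<n. - (w $ (k + 2) * \<xi> ^ (k + 2))) \<le> r * \<xi>"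
      by (simp only: sum.lessThan_Suc)
  qed
  then have "summable (\<lambda>k. w $ (k + 2) * \<xi> ^ (k + 2))"
    by (simp only: summable_minus_iff)
  then show ?thesis by (rule summable_iff_shift[THEN iffD1])
qed

lemma radius_w: "fps_conv_radius w \<ge> 1"
  unfolding fps_conv_radius_def
proof (rule conv_radius_geI_ex')
  fix \<xi> :: real assume "0 < \<xi>" "ereal \<xi> < 1"
  then show "summable (\<lambda>k. w $ k * of_real \<xi> ^ k)"
    using summable_w[of \<xi>] by simp
qed

lemma less_radius: "0 < \<xi> \<Longrightarrow> \<xi> < 1 \<Longrightarrow> fps_conv_radius F \<ge> 1 \<Longrightarrow> ereal (norm \<xi>) < fps_conv_radius F"
  for \<xi> :: real and F :: "real fps"
  by (rule less_le_trans[of _ 1]) simp_all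

lemma radius_deriv_w: "fps_conv_radius (fps_deriv w) \<ge> 1"
  using radius_w fps_conv_radius_deriv by (rule order.trans)

text \<open>Letting the truncations converge gives one inequality. For the other, the sum of the
  series solves the equation exactly, so the difference of squares \<open>E\<close> has derivative
  \<open>- 2 c y (eval_fps w x - g x) \<le> 0\<close> along the orbit and starts at 0.\<close>

lemma eval_w:
  assumes \<xi>: "0 < \<xi>" "\<xi> < 1"
  shows "eval_fps w \<xi> = g \<xi>"
proof (rule antisym)
  have ge: "g \<zeta> \<le> eval_fps w \<zeta>" if "0 < \<zeta>" "\<zeta> < 1" for \<zeta>
  proof (rule LIMSEQ_le_const)
    have "(\<lambda>n. poly (fps_truncate n w) \<zeta>) \<longlonglongrightarrow> eval_fps w \<zeta>"
      unfolding poly_fps_truncate eval_fps_def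
      by (rule summable_LIMSEQ'[OF summable_w[OF that]])
    then show "(\<lambda>n. poly (fps_truncate n w) \<zeta>) \<longlonglongrightarrow> eval_fps w \<zeta>" .
    show "\<exists>N. \<forall>n\<ge>N. g \<zeta> \<le> poly (fps_truncate n w) \<zeta>"
      using truncation_greater[OF _ that] by (intro exI[of _ 2]) (auto intro: less_imp_le)
  qed
  show "g \<xi> \<le> eval_fps w \<xi>" by (rule ge[OF \<xi>])
  obtain e where e: "0 < e" "e < 1" "\<And>\<xi>. \<bar>\<xi>\<bar> < e \<Longrightarrow> eval_fps w \<xi> = g \<xi>"
    using expansion_radius by blast
  define \<epsilon> where "\<epsilon> = min (e / 2) \<xi>"
  have \<epsilon>: "0 < \<epsilon>" "\<epsilon> \<le> \<xi>" "\<bar>\<epsilon>\<bar> < e" using e \<xi> by (auto simp: \<epsilon>_def)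
  obtain a b where ab: "a \<le> b" "x a = \<epsilon>" "x b = \<xi>"
    "\<And>t. a \<le> t \<Longrightarrow> t \<le> b \<Longrightarrow> 0 < x t \<and> x t < 1 \<and> 0 < y t"
    using orbit_segment[OF \<epsilon>(1,2) \<xi>(2)] by blast
  define E where "E = (\<lambda>t. eval_fps w (x t) * eval_fps w (x t) - y t * y t)"
  have "E b \<le> E a"
  proof (rule DERIV_nonpos_imp_nonincreasing[OF ab(1)])
    fix t assume t: "a \<le> t" "t \<le> b"
    then have xt: "0 < x t" "x t < 1" and yt: "0 < y t" using ab(4)[of t] by auto
    have "(eval_fps w has_real_derivative eval_fps (fps_deriv w) (x t)) (at (x t))"
      by (rule has_field_derivative_eval_fps[OF less_radius[OF xt radius_w]])
    then have wx: "((\<lambda>t. eval_fps w (x t)) has_real_derivative eval_fps (fps_deriv w) (x t) * y t) (at t)"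
      by (rule DERIV_chain2[OF _ x_deriv])
    have "eval_fps (w * fps_deriv w) (x t) = eval_fps (fps_X - fps_X\<^sup>2 - fps_const c * w) (x t)"
      by (simp only: ode)
    moreover have "eval_fps (w * fps_deriv w) (x t) = eval_fps w (x t) * eval_fps (fps_deriv w) (x t)"
      by (intro eval_fps_mult less_radius[OF xt] radius_w radius_deriv_w)
    moreover have "eval_fps (fps_X - fps_X\<^sup>2 - fps_const c * w) (x t) = x t - (x t)\<^sup>2 - c * eval_fps w (x t)"
    proof -
      have 1: "fps_conv_radius (fps_const c * w) \<ge> 1"
        by (rule order.trans[OF _ fps_conv_radius_mult]) (simp add: radius_w)
      have 2: "fps_conv_radius (fps_X - fps_X\<^sup>2 :: real fps) \<ge> 1"
        by (rule order.trans[OF _ fps_conv_radius_diff]) simp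
      show ?thesis
        using less_radius[OF xt 1] less_radius[OF xt 2] less_radius[OF xt radius_w]
        by (simp add: eval_fps_diff eval_fps_mult eval_fps_power)
    qed
    ultimately have ode': "eval_fps w (x t) * eval_fps (fps_deriv w) (x t) = x t - (x t)\<^sup>2 - c * eval_fps w (x t)"
      by simp
    let ?E' = "2 * y t * (eval_fps w (x t) * eval_fps (fps_deriv w) (x t) - (x t - (x t)\<^sup>2 - c * y t))"
    have deriv_E: "(E has_real_derivative ?E') (at t)"
      using DERIV_diff[OF DERIV_mult'[OF wx wx] DERIV_mult'[OF y_deriv y_deriv]]
      unfolding E_def by (rule DERIV_cong) (simp add: algebra_simps)
    have "?E' = - 2 * c * (y t * (eval_fps w (x t) - g (x t)))"
      unfolding ode' by (simp add: y_eq algebra_simps)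
    moreover have "y t * (eval_fps w (x t) - g (x t)) \<ge> 0"
      using ge[OF xt] yt by simp
    then have "c * (y t * (eval_fps w (x t) - g (x t))) \<ge> 0"
      using c_nonneg by (rule mult_nonneg_nonneg[rotated])
    ultimately have "?E' \<le> 0" by linarith
    with deriv_E show "\<exists>z. (E has_real_derivative z) (at t) \<and> z \<le> 0" by blast
  qed
  moreover have "E a = 0" using e(3)[OF \<epsilon>(3)] ab by (simp add: E_def y_eq)
  ultimately have "(eval_fps w \<xi> - g \<xi>) * (eval_fps w \<xi> + g \<xi>) \<le> 0"
    using ab by (simp add: E_def y_eq algebra_simps)
  then show "eval_fps w \<xi> \<le> g \<xi>"
    using ge[OF \<xi>] g_pos[OF \<xi>] by (simp add: mult_le_0_iff)
qed

lemma radius_S: "fps_conv_radius S \<ge> 1"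
proof -
  have "fps_conv_radius (fps_const r - fps_deriv w) \<ge> 1"
    by (rule order.trans[OF _ fps_conv_radius_diff]) (simp add: radius_deriv_w)
  then show ?thesis by (simp add: S_def)
qed

lemma g_mult_denominator:
  assumes \<xi>: "0 < \<xi>" "\<xi> < 1"
  shows "g \<xi> * (1 - r * \<xi> * eval_fps S \<xi>) = r * \<xi> * (1 - \<xi>)"
proof -
  have 1: "fps_conv_radius (fps_const r * fps_X * S) \<ge> 1"
    by (rule order.trans[OF _ fps_conv_radius_mult])
       (auto simp: radius_S intro!: order.trans[OF _ fps_conv_radius_mult])
  have 2: "fps_conv_radius (1 - fps_const r * fps_X * S) \<ge> 1"
    by (rule order.trans[OF _ fps_conv_radius_diff]) (simp add: 1)
  have 3: "fps_conv_radius (fps_const r * fps_X :: real fps) \<ge> 1"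
    by (rule order.trans[OF _ fps_conv_radius_mult]) simp
  have 4: "fps_conv_radius (1 - fps_X :: real fps) \<ge> 1"
    by (rule order.trans[OF _ fps_conv_radius_diff]) simp
  have "eval_fps (w * (1 - fps_const r * fps_X * S)) \<xi> = eval_fps (fps_const r * fps_X * (1 - fps_X)) \<xi>"
    by (simp only: w_mult_denominator)
  then show ?thesis
    using less_radius[OF \<xi> radius_w] less_radius[OF \<xi> radius_S] less_radius[OF \<xi> 1] less_radius[OF \<xi> 2]
      less_radius[OF \<xi> 3] less_radius[OF \<xi> 4] eval_w[OF \<xi>]
    by (simp add: eval_fps_diff eval_fps_mult)
qed

lemma denominator_pos:
  assumes \<xi>: "0 < \<xi>" "\<xi> < 1"
  shows "0 < 1 - r * \<xi> * eval_fps S \<xi>"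
proof -
  have "0 < g \<xi> * (1 - r * \<xi> * eval_fps S \<xi>)"
    unfolding g_mult_denominator[OF \<xi>] using r_pos \<xi> by simp
  then show ?thesis using g_pos[OF \<xi>] by (simp add: zero_less_mult_iff)
qed

end

section \<open>From the separatrix function to the chain of inequalities\<close>

lemma saddle_rate_pos: "0 < saddle_rate c"
  and saddle_rate_eq: "(saddle_rate c)\<^sup>2 + c * saddle_rate c = 1"
proof -
  have "sqrt (c\<^sup>2) < sqrt (c\<^sup>2 + 4)" by (rule real_sqrt_less_mono) simp
  then show "0 < saddle_rate c" by (simp add: saddle_rate_def)
  have "(sqrt (c\<^sup>2 + 4))\<^sup>2 = c\<^sup>2 + 4" by simp
  then show "(saddle_rate c)\<^sup>2 + c * saddle_rate c = 1"
    unfolding saddle_rate_def by (simp add: power2_eq_square field_simps)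
qed

lemma separatrix_function_orbit:
  assumes c: "0 \<le> c" and h: "separatrix_function c h"
  obtains x y w where "separatrix_orbit c (saddle_rate c) (\<lambda>x. - h (1 - x)) x y w"
    "\<And>n u. poly (taylor_poly n h 1) u = - poly (fps_truncate n w) (1 - u)"
proof -
  have orbit: "heteroclinic_orbit c = {(u, h u) | u. u \<in> {0..1}}"
    using h by (simp add: separatrix_function_def)
  obtain H where H: "(\<lambda>x. h (1 + x)) has_fps_expansion H"
    using h by (auto simp: separatrix_function_def real_analytic_at_def)
  define w where "w = Abs_fps (\<lambda>k. - ((- 1) ^ k * H $ k))"
  have w: "(\<lambda>x. - h (1 - x)) has_fps_expansion w"
    using has_fps_expansion_reflect[OF H] by (simp add: w_def)
  have "(0, 0) \<in> heteroclinic_orbit c" "(1, 0) \<in> heteroclinic_orbit c"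
    by (auto simp: heteroclinic_orbit_def)
  then have h01: "h 0 = 0" "h 1 = 0" unfolding orbit by auto
  \<comment> \<open>The point over \<open>u = 1 / 2\<close> is not an endpoint of the orbit, so it
    supplies a genuine connecting solution \<open>z\<close>.\<close>
  have "(1 / 2, h (1 / 2)) \<in> heteroclinic_orbit c" unfolding orbit
    by (intro CollectI exI[of _ "1 / 2"]) simp
  then obtain z where z: "solves_system c UNIV z" "(z \<longlongrightarrow> (1, 0)) at_bot" "(z \<longlongrightarrow> (0, 0)) at_top"
    by (auto simp: heteroclinic_orbit_def)
  then have "range z \<subseteq> heteroclinic_orbit c" unfolding heteroclinic_orbit_def by blast
  then have "z t \<in> {(u, h u) | u. u \<in> {0..1}}" for t
    unfolding orbit by blast
  then have "\<exists>u\<in>{0..1}. z t = (u, h u)" for t by blast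
  then have graph: "snd (z t) = h (fst (z t))" "fst (z t) \<in> {0..1}" for t
    by (metis fst_conv snd_conv)+
  have dz: "((\<lambda>s. fst (z s)) has_real_derivative snd (z t)) (at t)"
    "((\<lambda>s. snd (z s)) has_real_derivative (- c * snd (z t) - fst (z t) * (1 - fst (z t)))) (at t)" for t
    using z(1) by (auto simp: solves_system_def)
  define x y where "x = (\<lambda>t. 1 - fst (z t))" "y = (\<lambda>t. - snd (z t))"
  interpret orbit_expansion c "\<lambda>x. - h (1 - x)" x y w
  proof
    fix t
    show "(x has_real_derivative y t) (at t)"
      unfolding x_y_def by (rule derivative_eq_intros dz refl)+ simp
    show "(y has_real_derivative x t - (x t)\<^sup>2 - c * y t) (at t)"
      unfolding x_y_def
      by (rule DERIV_cong[OF DERIV_minus[OF dz(2)]]) (simp add: power2_eq_square algebra_simps)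
    show "x t \<in> {0..1}" using graph(2)[of t] by (simp add: x_y_def)
    show "y t = - h (1 - x t)" using graph(1)[of t] by (simp add: x_y_def)
    show "(x \<longlongrightarrow> 0) at_bot"
      unfolding x_y_def using tendsto_diff[OF tendsto_const[of 1] tendsto_fst[OF z(2)]] by simp
    show "(x \<longlongrightarrow> 1) at_top"
      unfolding x_y_def using tendsto_diff[OF tendsto_const[of 1] tendsto_fst[OF z(3)]] by simp
  qed (use c h01 w in simp_all)
  have "separatrix_orbit c (saddle_rate c) (\<lambda>x. - h (1 - x)) x y w"
    by unfold_locales
       (simp_all add: saddle_rate_pos saddle_rate_eq w_0 formal_ode w_1[OF saddle_rate_pos saddle_rate_eq, simplified])
  moreover have "poly (taylor_poly n h 1) u = - poly (fps_truncate n w) (1 - u)" for n u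
    unfolding w_def by (rule poly_taylor_poly_reflect[OF H])
  ultimately show thesis by (rule that)
qed

theorem theorem1p2:
  fixes c :: real and h :: "real \<Rightarrow> real"
  assumes "c \<ge> 2"
    and "separatrix_function c h"
  shows "\<forall>u\<in>{0<..<1}.
      (\<forall>n\<in>{2..<100}. poly (taylor_poly n h 1) u < poly (taylor_poly (Suc n) h 1) u) \<and>
      poly (taylor_poly 100 h 1) u < h u \<and>
      h u < R_upper c h 10 u \<and>
      (\<forall>m\<in>{1..<10}. R_upper c h (Suc m) u < R_upper c h m u)"
proof
  fix u :: real assume u: "u \<in> {0<..<1}"
  define r where "r = saddle_rate c"
  define x where "x = 1 - u"
  have x: "0 < x" "x < 1" using u by (auto simp: x_def)
  have "0 \<le> c" using assms(1) by simp
  then obtain X Y w where sep: "separatrix_orbit c r (\<lambda>x. - h (1 - x)) X Y w"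
    and taylor: "\<And>n u. poly (taylor_poly n h 1) u = - poly (fps_truncate n w) (1 - u)"
    unfolding r_def using separatrix_function_orbit assms(2) by blast
  interpret separatrix_orbit c r "\<lambda>x. - h (1 - x)" X Y w by (rule sep)
  have "pcompose (taylor_poly 22 h 1) [:1, - 1:] = - fps_truncate 22 w"
    by (rule poly_eq_poly_eq_iff[THEN iffD1]) (simp add: fun_eq_iff poly_pcompose taylor)
  then have "R_series c h $ k = G $ k" if "k < 22" for k
    using truncation_quotient_nth[OF that] by (simp add: R_series_def r_def)
  \<comment> \<open>For \<open>m \<le> 10\<close> only coefficients up to
    \<open>2 * m \<le> 20\<close> enter, and those below 22 are unaffected by the
    truncation.\<close>
  then have "pade m (R_series c h) x = poly (den m) x / poly (den' r m) x" if "m \<le> 10" for m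
    using that by (intro pade_eq_den[OF _ G_mult]
        pade_inequalities(1)[OF radius_S x r_pos denominator_pos[OF x]]) auto
  moreover have "r * x * (x - 1) = - (r * x * (1 - x))" by (simp add: algebra_simps)
  ultimately have R_upper: "R_upper c h m u = - (r * x * (1 - x)) * (poly (den m) x / poly (den' r m) x)"
    if "m \<le> 10" for m
    using that by (simp only: R_upper_def Let_def flip: x_def r_def)
  \<comment> \<open>Multiplication by the negative of this factor reverses the order: increasing
    lower bounds for \<open>1 / (1 - r x S)\<close> become decreasing upper bounds for
    \<open>h\<close>.\<close>
  have factor: "r * x * (1 - x) > 0" using r_pos x by simp
  have h_u: "h u = - (r * x * (1 - x)) * (1 / (1 - r * x * eval_fps S x))"
    using g_mult_denominator[OF x] denominator_pos[OF x] by (simp add: x_def field_simps)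
  show "(\<forall>n\<in>{2..<100}. poly (taylor_poly n h 1) u < poly (taylor_poly (Suc n) h 1) u) \<and>
      poly (taylor_poly 100 h 1) u < h u \<and>
      h u < R_upper c h 10 u \<and>
      (\<forall>m\<in>{1..<10}. R_upper c h (Suc m) u < R_upper c h m u)"
  proof (intro conjI ballI)
    fix n :: nat assume "n \<in> {2..<100}"
    then have "w $ Suc n * x ^ Suc n < 0"
      using w_neg'[of "Suc n"] x by (simp add: mult_less_0_iff del: power_Suc)
    then show "poly (taylor_poly n h 1) u < poly (taylor_poly (Suc n) h 1) u"
      by (simp add: taylor poly_fps_truncate flip: x_def)
  next
    show "poly (taylor_poly 100 h 1) u < h u"
      using truncation_greater[of 100 x] x by (simp add: taylor x_def)
  next
    show "h u < R_upper c h 10 u"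
      unfolding h_u R_upper[OF order_refl] using factor
        pade_inequalities(2)[OF radius_S x r_pos denominator_pos[OF x], of 10]
      by (intro mult_strict_left_mono_neg) auto
  next
    fix m :: nat assume m: "m \<in> {1..<10}"
    then have "poly (den m) x / poly (den' r m) x < poly (den (Suc m)) x / poly (den' r (Suc m)) x"
      using pade_inequalities(3)[OF radius_S x r_pos denominator_pos[OF x], of m] by simp
    moreover have "m \<le> 10" "Suc m \<le> 10" using m by auto
    ultimately show "R_upper c h (Suc m) u < R_upper c h m u"
      unfolding R_upper[OF \<open>m \<le> 10\<close>] R_upper[OF \<open>Suc m \<le> 10\<close>]
      using factor by (intro mult_strict_left_mono_neg) auto
  qed
qed

end
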